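(* For every positive integer $t$ there exist integers $0 < n_1 < \cdots < n_t$, a constant $0 < \lambda_t < 1/6$, and a finite family $\mathcal{M}_t$ of triple systems such that $\mathrm{proj}\,\Omega(\mathcal{M}_t) = [0,1]$ and $g(\mathcal{M}_t)(x) \le 6\lambda_t$ for all $x\in[0,1]$. Moreover, for $x\in[0,1]$ we have $g(\mathcal{M}_t)(x) = 6\lambda_t$ if and only if $x = 1-1/n_i$ for some $i\in[t]$.
   Context: An $r$-graph is an $r$-uniform hypergraph on a finite vertex set, identified with its edge set; $v(\mathcal{H})$ is its number of vertices. A triple system is a $3$-graph. For a family $\mathcal{F}$ of $r$-graphs, an $r$-graph is $\mathcal{F}$-free if it contains no member of $\mathcal{F}$ as a (not necessarily induced) subgraph. The shadow $\partial\mathcal{H}$ of an $r$-graph $\mathcal{H}$ is the $(r-1)$-graph on $V(\mathcal{H})$ of all $(r-1)$-sets contained in some edge of $\mathcal{H}$. Put $d(\mathcal{H})=|\mathcal{H}|/\binom{v(\mathcal{H})}{r}$ and $d(\partial\mathcal{H})=|\partial\mathcal{H}|/\binom{v(\mathcal{H})}{r-1}$. The feasible region $\Omega(\mathcal{F})$ is the set of points $(x,y)\in[0,1]^2$ for which there is a sequence $(\mathcal{H}_k)_{k\ge1}$ of $\mathcal{F}$-free $r$-graphs with $v(\mathcal{H}_k)\to\infty$, $d(\partial\mathcal{H}_k)\to x$ and $d(\mathcal{H}_k)\to y$. Its projection is $\mathrm{proj}\,\Omega(\mathcal{F})=\{x\colon (x,y)\in\Omega(\mathcal{F})\text{ for some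 }y\in[0,1]\}$. The feasible region function $g(\mathcal{F})\colon\mathrm{proj}\,\Omega(\mathcal{F})\to[0,1]$ is $g(\mathcal{F})(x)=\max\{y\colon(x,y)\in\Omega(\mathcal{F})\}$ (it is known that $\Omega(\mathcal{F})$ is exactly the region $\{(x,y)\colon x\in\mathrm{proj}\,\Omega(\mathcal{F}),\ 0\le y\le g(\mathcal{F})(x)\}$). $[t]=\{1,\dots,t\}$. *)

theory Defs
  imports "HOL-Analysis.Analysis" "HOL-Library.Ramsey"
begin

text \<open>A hypergraph is a pair of a vertex set and an edge set. Every finite hypergraph is
  isomorphic to one with vertices in \<^typ>\<open>nat\<close>, and all notions below are invariant
  under isomorphism.\<close>

type_synonym hypergraph = "nat set \<times> nat set set"

abbreviation verts :: "hypergraph \<Rightarrow> nat set" where "verts \<equiv> fst"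
abbreviation edges :: "hypergraph \<Rightarrow> nat set set" where "edges \<equiv> snd"

definition r_graph :: "nat \<Rightarrow> hypergraph \<Rightarrow> bool" where
  "r_graph r H \<longleftrightarrow> finite (verts H) \<and> edges H \<subseteq> nsets (verts H) r"

abbreviation triple_system :: "hypergraph \<Rightarrow> bool" where
  "triple_system \<equiv> r_graph 3"

definition contains :: "hypergraph \<Rightarrow> hypergraph \<Rightarrow> bool" where
  "contains H F \<longleftrightarrow> (\<exists>f. inj_on f (verts F) \<and> f ` verts F \<subseteq> verts H \<and> (\<forall>e\<in>edges F. f ` e \<in> edges H))"

definition free_of :: "hypergraph set \<Rightarrow> hypergraph \<Rightarrow> bool" where
  "free_of \<F> H \<longleftrightarrow> (\<forall>F\<in>\<F>. \<not> contains H F)"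

definition shadow :: "nat \<Rightarrow> hypergraph \<Rightarrow> hypergraph" where
  "shadow r H = (verts H, {s \<in> nsets (verts H) (r - 1). \<exists>e\<in>edges H. s \<subseteq> e})"

text \<open>The uniformity is an argument, since it cannot be read off from the edge set. If
  \<open>H\<close> has fewer than \<open>r\<close> vertices, the quotient is \<open>0 / 0 = 0\<close>; this does not affect limits
  along sequences with the number of vertices tending to infinity.\<close>

definition density :: "nat \<Rightarrow> hypergraph \<Rightarrow> real" where
  "density r H = real (card (edges H)) / real (card (verts H) choose r)"

definition feasible_region :: "nat \<Rightarrow> hypergraph set \<Rightarrow> (real \<times> real) set" where
  "feasible_region r \<F> = {(x, y). x \<in> {0..1} \<and> y \<in> {0..1} \<and>
     (\<exists>H :: nat \<Rightarrow> hypergraph.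
        (\<forall>k. r_graph r (H k) \<and> free_of \<F> (H k)) \<and>
        filterlim (\<lambda>k. card (verts (H k))) at_top sequentially \<and>
        (\<lambda>k. density (r - 1) (shadow r (H k))) \<longlonglongrightarrow> x \<and>
        (\<lambda>k. density r (H k)) \<longlonglongrightarrow> y)}"

definition proj_feasible :: "nat \<Rightarrow> hypergraph set \<Rightarrow> real set" where
  "proj_feasible r \<F> = {x. \<exists>y\<in>{0..1}. (x, y) \<in> feasible_region r \<F>}"

text \<open>Meaningful only for \<open>x \<in> proj_feasible r \<F>\<close>, where the maximum is attained.\<close>

definition feasible_fun :: "nat \<Rightarrow> hypergraph set \<Rightarrow> real \<Rightarrow> real" where
  "feasible_fun r \<F> x = (GREATEST y. (x, y) \<in> feasible_region r \<F>)"

end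

theory Submission
  imports Defs "HOL-Real_Asymp.Real_Asymp"
begin

text \<open>
  The proof rests on three observations.

  \<^bold>\<open>A union of feasible regions.\<close> Let \<open>P\<^sub>0, \<dots>, P\<^sub>t\<close> be properties that pass to
  subhypergraphs. Forbid every small triple system that violates all of them. A triple system
  that contains none of the forbidden ones satisfies one of the properties on all its small
  parts: otherwise the union of one small violation for each \<open>P\<^sub>i\<close> would be forbidden
  (\<open>free_of_joint_obstructionsD\<close>). So it
  suffices to treat one property at a time, and the feasible region of the finite family is the
  union of the regions for the individual \<open>P\<^sub>i\<close>. Here \<open>P\<^sub>0\<close> says that all edges share a vertex;
  it provides the points \<open>(x, 0)\<close> for all \<open>x\<close> in \<open>[0, 1]\<close> and no point above them. For
  \<open>i \<ge> 1\<close>, \<open>P\<^sub>i\<close> says that there is a homomorphism to a fixed triple system \<open>G\<^sub>i\<close> (in other words,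
  that the triple system is contained in a blow-up of \<open>G\<^sub>i\<close>).

  \<^bold>\<open>Stability by symmetrization.\<close> Let \<open>H\<close> be a triple system on \<open>N\<close> vertices whose small parts
  have homomorphisms to \<open>G\<close>, a triple system on \<open>n\<close> vertices. For real \<open>b\<close> consider the polynomial
  \<open>p\<^sub>H(w) + b q(w)\<close> in vertex weights \<open>w\<close>, where \<open>p\<^sub>H\<close> is the sum of the edge monomials and \<open>q\<close>
  that of the monomials of the shadow. If \<open>u\<close> and \<open>v\<close> lie in no common edge, no monomial contains
  both, so the weight of one of them can be moved to the other without decreasing the
  polynomial (\<open>symmetrization\<close>). Hence on the simplex it is dominated by its values at weights carried by a clique
  of the shadow. Such a clique embeds into \<open>G\<close>. With \<open>e\<close> edges in \<open>H\<close> and \<open>s\<close> pairs in its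
  shadow, this gives \<open>e / N\<^sup>3 + b s / N\<^sup>2 \<le> p\<^sub>G(y) + b (1 - \<Sum>y\<^sub>i\<^sup>2) / 2\<close> for some weights \<open>y\<close> on
  the vertices of \<open>G\<close> (\<open>lagrangian_transfer\<close>). Suppose that \<open>p\<^sub>G\<close> has a strict quadratic maximum at the uniform
  weights (\<open>uniform_pattern\<close>), namely \<open>6 p\<^sub>G(y) \<le> \<alpha> - (\<Sum>y\<^sub>i\<^sup>2 - 1/n) / 2\<close>. Then \<open>b = 0\<close> shows that the density is at most
  \<open>\<alpha>\<close>. The same argument for \<open>q\<close> alone bounds the shadow density by \<open>1 - 1/n\<close>, and \<open>b = -1/6\<close>
  shows that a density near \<open>\<alpha>\<close> forces a shadow density near \<open>1 - 1/n\<close>. The blow-ups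
  of \<open>G\<close> attain both values.

  \<^bold>\<open>Patterns with equal Lagrangians.\<close> Let \<open>G\<close> be the complete triple system on \<open>n\<close> vertices with
  an \<open>r\<close>-regular system removed. If \<open>r \<le> C \<surd>n\<close> and \<open>n\<close> is large in terms of \<open>C\<close>, then
  \<open>p\<^sub>G\<close> has a strict quadratic maximum at the uniform weights (\<open>wsum_co_regular_le\<close>). The choice
  \<open>n = Q(3Q + 2i)\<close> and \<open>r = i(3Q + 2i) + 1\<close>, with \<open>Q\<close> large in terms of \<open>t\<close>, gives \<open>(n - 1)(n - 2) - 2r = n\<^sup>2 - (3Q + 2i)\<^sup>2\<close>, and so
  \<open>\<alpha> = 1 - 1/Q\<^sup>2\<close> for every \<open>i\<close>.
\<close>

section \<open>Elementary symmetric sums over set systems\<close>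

text \<open>For an \<open>r\<close>-graph with edge set \<open>A\<close> this is its Lagrangian polynomial.\<close>
definition wsum :: "'a set set \<Rightarrow> ('a \<Rightarrow> real) \<Rightarrow> real" where
  "wsum A w = (\<Sum>e\<in>A. \<Prod>v\<in>e. w v)"

lemma wsum_nonneg:
  assumes "\<And>e v. e \<in> A \<Longrightarrow> v \<in> e \<Longrightarrow> 0 \<le> w v"
  shows "0 \<le> wsum A w"
  unfolding wsum_def using assms by (intro sum_nonneg prod_nonneg) auto

lemma nsets_insert_Suc:
  assumes "a \<notin> V"
  shows "nsets (insert a V) (Suc k) = nsets V (Suc k) \<union> insert a ` nsets V k"
proof (intro equalityI subsetI)
  fix X assume X: "X \<in> nsets (insert a V) (Suc k)"
  show "X \<in> nsets V (Suc k) \<union> insert a ` nsets V k"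
  proof (cases "a \<in> X")
    case True
    then have "X = insert a (X - {a})" "X - {a} \<in> nsets V k"
      using X by (auto simp: nsets_def)
    then show ?thesis by blast
  qed (use X in \<open>auto simp: nsets_def\<close>)
next
  fix X assume "X \<in> nsets V (Suc k) \<union> insert a ` nsets V k"
  then show "X \<in> nsets (insert a V) (Suc k)"
    using assms by (auto simp: nsets_def card_insert_if subset_iff)
qed

lemma wsum_nsets_insert:
  assumes "finite V" "a \<notin> V"
  shows "wsum (nsets (insert a V) (Suc k)) w = wsum (nsets V (Suc k)) w + w a * wsum (nsets V k) w"
proof -
  have "inj_on (insert a) (nsets V k)"
    using assms(2) by (intro inj_onI) (auto simp: nsets_def)
  moreover have "(\<Prod>v\<in>insert a X. w v) = w a * (\<Prod>v\<in>X. w v)" if "X \<in> nsets V k" for X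
    using that assms by (subst prod.insert) (auto simp: nsets_def)
  ultimately have "wsum (insert a ` nsets V k) w = w a * wsum (nsets V k) w"
    unfolding wsum_def by (simp add: sum.reindex sum_distrib_left)
  moreover have "nsets V (Suc k) \<inter> insert a ` nsets V k = {}"
    using assms(2) by (auto simp: nsets_def)
  ultimately show ?thesis
    using assms by (simp add: wsum_def nsets_insert_Suc sum.union_disjoint finite_imp_finite_nsets)
qed

lemma wsum_nsets_0: "wsum (nsets V 0) w = 1"
  by (simp add: wsum_def nsets_def cong: conj_cong)

lemma wsum_nsets_1:
  assumes "finite V" shows "wsum (nsets V (Suc 0)) w = sum w V"
  using assms
proof (induction V)
  case empty
  show ?case by (simp add: wsum_def nsets_eq_empty)
next
  case (insert a V)
  then show ?case using wsum_nsets_insert[OF insert.hyps, of 0 w, unfolded wsum_nsets_0] by simp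
qed

lemma wsum_nsets_2:
  assumes "finite V"
  shows "2 * wsum (nsets V 2) w = (sum w V)^2 - (\<Sum>v\<in>V. (w v)^2)"
  using assms unfolding numeral_2_eq_2
proof (induction V)
  case empty
  show ?case by (simp add: wsum_def nsets_eq_empty)
next
  case (insert a V)
  then show ?case
    by (simp add: wsum_nsets_insert wsum_nsets_1 power2_eq_square[unfolded numeral_2_eq_2] algebra_simps)
qed

lemma wsum_nsets_3:
  assumes "finite V"
  shows "6 * wsum (nsets V 3) w =
    (sum w V)^3 - 3 * sum w V * (\<Sum>v\<in>V. (w v)^2) + 2 * (\<Sum>v\<in>V. (w v)^3)"
  using assms
proof (induction V)
  case empty
  show ?case by (simp add: wsum_def nsets_eq_empty)
next
  case (insert a V)
  have "6 * wsum (nsets (insert a V) 3) w = 6 * wsum (nsets V 3) w + 3 * w a * (2 * wsum (nsets V 2) w)"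
    using wsum_nsets_insert[OF insert.hyps, of 2 w] by (simp add: eval_nat_numeral)
  also have "\<dots> = (sum w V)^3 - 3 * sum w V * (\<Sum>v\<in>V. (w v)^2) + 2 * (\<Sum>v\<in>V. (w v)^3)
       + 3 * w a * ((sum w V)^2 - (\<Sum>v\<in>V. (w v)^2))"
    by (simp only: insert.IH wsum_nsets_2[OF insert.hyps(1)])
  also have "\<dots> = (w a + sum w V)^3 - 3 * (w a + sum w V) * ((w a)^2 + (\<Sum>v\<in>V. (w v)^2)) + 2 * ((w a)^3 + (\<Sum>v\<in>V. (w v)^3))"
    by (simp add: power2_eq_square power3_eq_cube algebra_simps)
  finally show ?case using insert.hyps by simp
qed

section \<open>Complete triple systems with a sparse regular system removed\<close>

lemma sum_regular:
  fixes f :: "'a \<Rightarrow> real"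
  assumes "finite V" "D \<subseteq> Pow V" "\<And>v. v \<in> V \<Longrightarrow> card {e\<in>D. v \<in> e} = r"
  shows "(\<Sum>e\<in>D. sum f e) = real r * sum f V"
proof -
  have fin: "finite D" using assms(1,2) finite_subset by blast
  have "(\<Sum>e\<in>D. sum f e) = (\<Sum>e\<in>D. \<Sum>v\<in>V. if v \<in> e then f v else 0)"
  proof (rule sum.cong[OF refl])
    fix e assume "e \<in> D"
    then have "V \<inter> e = e" using assms(2) by auto
    then show "sum f e = (\<Sum>v\<in>V. if v \<in> e then f v else 0)"
      using assms(1) by (simp flip: sum.inter_restrict)
  qed
  also have "\<dots> = (\<Sum>v\<in>V. \<Sum>e\<in>D. if v \<in> e then f v else 0)"
    by (rule sum.swap)
  also have "\<dots> = (\<Sum>v\<in>V. real r * f v)"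
    using fin assms(3) by (intro sum.cong refl) (simp add: sum.If_cases Int_def)
  finally show ?thesis by (simp add: sum_distrib_left)
qed

text \<open>Here \<open>u\<close> is the uniform weight, and \<open>a, b, c\<close> are the deviations from it on an edge. The edge
  monomial falls below its linear part by at most a multiple of the squared deviations, and that
  multiple stays small after summation over a sparse system.\<close>
lemma edge_monomial_ge:
  fixes a b c u s :: real
  assumes "0 \<le> u" "\<bar>c\<bar> \<le> s"
  shows "u^3 + u^2 * (a + b + c) - (u + s) * (a^2 + b^2 + c^2) \<le> (u + a) * (u + b) * (u + c)"
proof -
  have "2 * (a*b) \<ge> - (a^2 + b^2)" "2 * (a*b) \<le> a^2 + b^2"
    using sum_squares_bound[of a b] sum_squares_bound[of "-a" b] by auto
  then have ab: "\<bar>a * b\<bar> \<le> a^2 + b^2" by linarith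
  have "\<bar>a * b * c\<bar> \<le> (a^2 + b^2) * s"
    unfolding abs_mult[of "a*b"] using ab assms(2) by (intro mult_mono) auto
  moreover have "0 \<le> s * c^2" using assms(2) by simp
  ultimately have cub: "a * b * c \<ge> - (s * (a^2 + b^2 + c^2))"
    by (simp add: algebra_simps)
  have "0 \<le> (a + b + c)^2 + a^2 + b^2 + c^2" by simp
  then have "a*b + b*c + a*c \<ge> - (a^2 + b^2 + c^2)"
    by (simp add: power2_eq_square algebra_simps)
  from mult_left_mono[OF this assms(1)]
  have "u * (a*b + b*c + a*c) \<ge> - (u * (a^2 + b^2 + c^2))" by (simp only: mult_minus_right)
  moreover have "(u + a) * (u + b) * (u + c) = u^3 + u^2 * (a + b + c) + u * (a*b + b*c + a*c) + a*b*c"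
    by (simp add: power2_eq_square power3_eq_cube algebra_simps)
  ultimately show ?thesis using cub by (simp add: algebra_simps)
qed

text \<open>Let \<open>W = \<Sum>y\<^sub>v\<^sup>2 - 1/n\<close>. Without the removed system, six times the polynomial is
  \<open>1 - 3 \<Sum>y\<^sub>v\<^sup>2 + 2 \<Sum>y\<^sub>v\<^sup>3\<close>, which falls off like \<open>3 W\<close>. The removed system contributes \<open>2r/n\<^sup>2\<close> at the
  uniform weights. If \<open>W \<ge> \<delta>/n\<close>, then this contribution is smaller than the gain from \<open>W\<close>, and
  non-negativity of the removed sum is enough. If \<open>W < \<delta>/n\<close>, the removed sum is expanded around
  the uniform weights: regularity makes its linear part vanish, and the higher terms are bounded
  by \<open>W\<close> times a quantity of order \<open>r/n + r \<surd>W\<close>. The last quantity is small because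
  \<open>r\<^sup>2 W \<le> r\<^sup>2 \<delta>/n \<le> 1/16\<close>.\<close>
lemma wsum_co_regular_le:
  fixes y :: "'a \<Rightarrow> real" and \<delta> :: real and r n :: nat
  assumes V: "finite V" "card V = n" and "0 < n"
    and D: "D \<subseteq> nsets V 3" "\<And>v. v \<in> V \<Longrightarrow> card {e\<in>D. v \<in> e} = r"
    and y: "\<And>v. v \<in> V \<Longrightarrow> 0 \<le> y v" "sum y V = 1"
    and \<delta>: "0 < \<delta>" "\<delta> \<le> 1/16" "16 * r^2 * \<delta> \<le> n" "2 * r \<le> \<delta> * n" "32 \<le> \<delta>^2 * n"
  shows "6 * wsum (nsets V 3 - D) y
     \<le> 1 - 3/n + 2/n^2 - 2*r/n^2 - ((\<Sum>v\<in>V. (y v)^2) - 1/n) / 2"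
proof -
  define P where "P = (\<Sum>v\<in>V. (y v)^2)"
  define T where "T = (\<Sum>v\<in>V. (y v)^3)"
  define u where "u = 1 / real n"
  define z where "z v = y v - u" for v
  define W where "W = (\<Sum>v\<in>V. (z v)^2)"
  have u: "0 < u" "real n * u = 1" using \<open>0 < n\<close> by (auto simp: u_def)
  have sumz: "sum z V = 0" using y(2) V u by (simp add: z_def sum_subtractf)
  have PW: "P = u + W"
  proof -
    have "P = (\<Sum>v\<in>V. (z v)^2 + 2 * u * z v + u^2)"
      unfolding P_def by (intro sum.cong refl) (simp add: z_def power2_eq_square algebra_simps)
    also have "\<dots> = W + 2 * u * sum z V + n * u^2"
      by (simp add: sum.distrib W_def V sum_distrib_left)
    finally show ?thesis using sumz u by (simp add: power2_eq_square)
  qed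
  have "0 \<le> W" unfolding W_def by (simp add: sum_nonneg)
  have finD: "finite D" using D(1) V(1) finite_subset finite_imp_finite_nsets by blast
  have e3: "6 * wsum (nsets V 3 - D) y = 1 - 3 * P + 2 * T - 6 * wsum D y"
  proof -
    have "wsum (nsets V 3 - D) y = wsum (nsets V 3) y - wsum D y"
      unfolding wsum_def using D(1) V(1) by (intro sum_diff finite_imp_finite_nsets)
    then show ?thesis using wsum_nsets_3[OF V(1), of y] y(2) by (simp add: P_def T_def)
  qed
  have pD: "0 \<le> wsum D y"
    using D(1) y(1) by (intro wsum_nonneg) (auto simp: nsets_def)
  have un: "2 * r * u \<le> \<delta>" "32 * u \<le> \<delta>^2"
    using \<delta>(4,5) \<open>0 < n\<close> by (simp_all add: u_def field_simps)
  have \<delta>2: "\<delta>^2 \<le> (1/16)^2" using \<delta>(1,2) by (intro power_mono) auto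
  have usmall: "u \<le> 1/8192" using un(2) \<delta>2 by (simp add: power2_eq_square)
  have goal: "6 * wsum (nsets V 3 - D) y \<le> 1 - 3 * u + 2 * u^2 - 2 * r * u^2 - W / 2"
  proof (cases "W \<ge> \<delta> * u")
    case True
    define s where "s = sqrt P"
    have "0 \<le> P" using PW u \<open>0 \<le> W\<close> by linarith
    have s: "0 \<le> s" "s^2 = P" using \<open>0 \<le> P\<close> by (auto simp: s_def)
    have ys: "y v \<le> s" if "v \<in> V" for v
    proof -
      have "(y v)^2 \<le> P" unfolding P_def using that V(1) by (intro member_le_sum) auto
      then show ?thesis unfolding s_def using real_le_rsqrt by blast
    qed
    have "T \<le> (\<Sum>v\<in>V. s * (y v)^2)"
    proof -
      have "y v * (y v)^2 \<le> s * (y v)^2" if "v \<in> V" for v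
        using ys[OF that] by (intro mult_right_mono) auto
      then show ?thesis unfolding T_def by (intro sum_mono) (simp add: power3_eq_cube power2_eq_square mult.assoc)
    qed
    then have T: "T \<le> s * P" by (simp add: P_def sum_distrib_left)
    have "y v \<le> 1" if "v \<in> V" for v
      using member_le_sum[OF that, of y] y V(1) by auto
    then have "P \<le> (\<Sum>v\<in>V. y v)"
      unfolding P_def using y(1) by (intro sum_mono) (simp add: power2_eq_square mult_left_le)
    then have "P \<le> 1" using y(2) by simp
    then have "s \<le> 1" unfolding s_def by simp
    have ru: "2 * r * u^2 \<le> \<delta> * u"
      using mult_right_mono[OF un(1), of u] u by (simp add: power2_eq_square)
    have "3 * P - 2 * s * P \<ge> 3 * u + 2 * r * u^2 + W / 2"
      \<comment> \<open>As \<open>\<Sum>y\<^sub>v\<^sup>3 \<le> s P\<close>, a small \<open>s\<close> leaves almost the full slope 3, while for large \<open>s\<close> the value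
        of \<open>P = s\<^sup>2\<close> alone exceeds everything of order \<open>1/n\<close>.\<close>
    proof (cases "s \<le> \<delta> / 2")
      case True
      have "2 * s * u \<le> \<delta> * u" using True u by simp
      have "s * W \<le> 1/4 * W"
        using True \<delta>(2) \<open>0 \<le> W\<close> by (intro mult_right_mono) auto
      then show ?thesis using \<open>2 * s * u \<le> \<delta> * u\<close> \<open>W \<ge> \<delta> * u\<close> ru
        unfolding PW by (simp add: algebra_simps)
    next
      case False
      then have "(\<delta>/2)^2 \<le> s^2" using \<delta>(1) by (intro power_mono) auto
      then have "P \<ge> \<delta>^2 / 4" using s by (simp add: power_divide)
      then have "P \<ge> 8 * u" using un by linarith
      have "s * P \<le> P" using \<open>s \<le> 1\<close> \<open>0 \<le> P\<close> by (simp add: mult_left_le_one_le s)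
      have "\<delta> * u \<le> u" using \<delta>(2) u by simp
      show ?thesis using \<open>P \<ge> 8 * u\<close> \<open>s * P \<le> P\<close> \<open>\<delta> * u \<le> u\<close> ru PW u by linarith
    qed
    moreover have "2 * T \<le> 2 * s * P" using T by simp
    moreover have "0 \<le> u^2" by simp
    ultimately show ?thesis using e3 pD by linarith
  next
    case False
    define \<sigma> where "\<sigma> = sqrt W"
    have \<sigma>: "0 \<le> \<sigma>" "\<sigma>^2 = W" using \<open>0 \<le> W\<close> by (auto simp: \<sigma>_def)
    have z\<sigma>: "\<bar>z v\<bar> \<le> \<sigma>" if "v \<in> V" for v
    proof -
      have "(z v)^2 \<le> W" unfolding W_def using that V(1) by (intro member_le_sum) auto
      then show ?thesis unfolding \<sigma>_def using real_sqrt_le_mono by fastforce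
    qed
    have "T = (\<Sum>v\<in>V. u^3 + 3 * u^2 * z v + 3 * u * (z v)^2 + (z v)^3)"
      unfolding T_def by (intro sum.cong refl) (simp add: z_def power2_eq_square power3_eq_cube algebra_simps)
    also have "\<dots> = n * u^3 + 3 * u^2 * sum z V + 3 * u * W + (\<Sum>v\<in>V. (z v)^3)"
      by (simp add: sum.distrib W_def V sum_distrib_left)
    also have "\<dots> = u^2 + 3 * u * W + (\<Sum>v\<in>V. (z v)^3)"
    proof -
      have "n * u^3 = (n * u) * u^2" by (simp add: power2_eq_square power3_eq_cube)
      then show ?thesis using sumz u by simp
    qed
    also have "(\<Sum>v\<in>V. (z v)^3) \<le> (\<Sum>v\<in>V. \<sigma> * (z v)^2)"
    proof (rule sum_mono)
      fix v assume "v \<in> V"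
      then have "z v * (z v)^2 \<le> \<sigma> * (z v)^2"
        using z\<sigma>[of v] by (intro mult_right_mono) auto
      then show "(z v)^3 \<le> \<sigma> * (z v)^2" by (simp add: power3_eq_cube power2_eq_square)
    qed
    also have "(\<Sum>v\<in>V. \<sigma> * (z v)^2) = \<sigma> * W" by (simp add: W_def sum_distrib_left)
    finally have T: "T \<le> u^2 + 3 * u * W + \<sigma> * W" by simp
    have "(\<Sum>e\<in>D. u^3 + u^2 * sum z e - (u + \<sigma>) * (\<Sum>v\<in>e. (z v)^2)) \<le> wsum D y"
      unfolding wsum_def
    proof (rule sum_mono)
      fix e assume "e \<in> D"
      then have "card e = 3" "e \<subseteq> V" using D(1) by (auto simp: nsets_def)
      then obtain a b c where e: "e = {a, b, c}" "a \<noteq> b" "b \<noteq> c" "a \<noteq> c" "c \<in> V"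
        by (auto simp: card_3_iff)
      have "(\<Prod>v\<in>e. y v) = (u + z a) * (u + z b) * (u + z c)"
        using e by (simp add: z_def)
      then show "u^3 + u^2 * sum z e - (u + \<sigma>) * (\<Sum>v\<in>e. (z v)^2) \<le> (\<Prod>v\<in>e. y v)"
        using edge_monomial_ge[of u "z c" \<sigma> "z a" "z b"] z\<sigma>[of c] e u by (simp add: add.assoc)
    qed
    also have "(\<Sum>e\<in>D. u^3 + u^2 * sum z e - (u + \<sigma>) * (\<Sum>v\<in>e. (z v)^2))
       = card D * u^3 + u^2 * (r * sum z V) - (u + \<sigma>) * (r * W)"
    proof -
      have DP: "D \<subseteq> Pow V" using D(1) by (auto simp: nsets_def)
      show ?thesis
        using sum_regular[OF V(1) DP D(2), of z] sum_regular[OF V(1) DP D(2), of "\<lambda>v. (z v)^2"]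
        by (simp add: sum.distrib sum_subtractf sum_distrib_left[symmetric] W_def)
    qed
    also have "card D * u^3 = r * u^2 / 3"
    proof -
      have DP: "D \<subseteq> Pow V" using D(1) by (auto simp: nsets_def)
      have "(\<Sum>e\<in>D. \<Sum>v\<in>e. (1::real)) = (\<Sum>e\<in>D. 3)"
        using D(1) by (intro sum.cong refl) (auto simp: nsets_def)
      then have "3 * real (card D) = r * n"
        using sum_regular[OF V(1) DP D(2), of "\<lambda>v. 1"] V by simp
      then have "3 * (card D * u^3) = r * u^2 * (n * u)" by (simp add: power2_eq_square power3_eq_cube algebra_simps)
      then show ?thesis using u by simp
    qed
    finally have "r * u^2 / 3 - (u + \<sigma>) * (r * W) \<le> wsum D y" using sumz by simp
    moreover have "6 * (u * W) + 2 * (\<sigma> * W) + 6 * ((u + \<sigma>) * (r * W)) \<le> 5/2 * W"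
    proof -
      have W: "W < \<delta> * u" using False by simp
      have "(4 * (r * \<sigma>))^2 = 16 * r^2 * W" using \<sigma> by (simp add: power_mult_distrib)
      also have "\<dots> \<le> 16 * r^2 * (\<delta> * u)" using W by (intro mult_left_mono) auto
      also have "\<dots> \<le> n * u" using mult_right_mono[OF \<delta>(3), of u] u by (simp add: mult.assoc)
      finally have "(4 * (r * \<sigma>))^2 \<le> 1^2" using u by simp
      then have r\<sigma>: "4 * (r * \<sigma>) \<le> 1" by (rule power2_le_imp_le) simp
      have "\<delta> * u \<le> 1/16 * (1/8192)" using \<delta> u usmall by (intro mult_mono) auto
      then have "\<sigma>^2 \<le> (1/16)^2" using W \<sigma> by (simp add: power2_eq_square)
      then have "\<sigma> \<le> 1/16" by (rule power2_le_imp_le) simp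
      then have "6 * u + 2 * \<sigma> + 6 * (u * r) + 6 * (r * \<sigma>) \<le> 5/2"
        using r\<sigma> un usmall \<delta>(2) by (simp add: algebra_simps)
      from mult_right_mono[OF this \<open>0 \<le> W\<close>] show ?thesis by (simp add: algebra_simps)
    qed
    ultimately show ?thesis using e3 T PW by (simp add: algebra_simps)
  qed
  have "W = P - 1 / real n" using PW u_def by simp
  with goal show ?thesis
    by (simp add: u_def P_def power_divide)
qed

section \<open>Symmetrization\<close>

definition adjacent :: "'a set set \<Rightarrow> 'a \<Rightarrow> 'a \<Rightarrow> bool" where
  "adjacent A u v \<longleftrightarrow> (\<exists>e\<in>A. u \<in> e \<and> v \<in> e)"

text \<open>If no member of \<open>A\<close> contains both \<open>u\<close> and \<open>v\<close>, every monomial is affine along the segment on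
  which weight is exchanged between \<open>u\<close> and \<open>v\<close>; the end points of the segment are the two weightings
  on the right.\<close>
lemma wsum_convex:
  assumes A: "\<And>e. e \<in> A \<Longrightarrow> finite e" and uv: "u \<noteq> v" "\<not> adjacent A u v" and pos: "w u + w v \<noteq> 0"
  defines "\<theta> \<equiv> w u / (w u + w v)"
  shows "wsum A w = \<theta> * wsum A (w(u := w u + w v, v := 0)) + (1 - \<theta>) * wsum A (w(u := 0, v := w u + w v))"
proof -
  define w1 where "w1 = w(u := w u + w v, v := 0)"
  define w2 where "w2 = w(u := 0, v := w u + w v)"
  have \<theta>: "\<theta> * (w u + w v) = w u" "(1 - \<theta>) * (w u + w v) = w v"
    using pos by (simp_all add: \<theta>_def field_simps)
  have "(\<Prod>x\<in>e. w x) = \<theta> * (\<Prod>x\<in>e. w1 x) + (1 - \<theta>) * (\<Prod>x\<in>e. w2 x)" if "e \<in> A" for e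
  proof -
    have fe: "finite e" and nuv: "\<not> (u \<in> e \<and> v \<in> e)"
      using that A uv by (auto simp: adjacent_def)
    have rest: "(\<Prod>x\<in>e-{u,v}. w1 x) = (\<Prod>x\<in>e-{u,v}. w x)" "(\<Prod>x\<in>e-{u,v}. w2 x) = (\<Prod>x\<in>e-{u,v}. w x)"
      by (auto simp: w1_def w2_def intro!: prod.cong)
    consider "u \<in> e" "v \<notin> e" | "u \<notin> e" "v \<in> e" | "u \<notin> e" "v \<notin> e" using nuv by blast
    then show ?thesis
    proof cases
      case 1
      then have e: "e = insert u (e - {u,v})" by auto
      have "(\<Prod>x\<in>e. g x) = g u * (\<Prod>x\<in>e-{u,v}. g x)" for g :: "_ \<Rightarrow> real"
        using fe by (subst e, subst prod.insert) auto
      moreover have "w1 u = w u + w v" "w2 u = 0" using uv(1) by (auto simp: w1_def w2_def)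
      moreover have "w u * R = \<theta> * ((w u + w v) * R)" for R
        unfolding mult.assoc[symmetric] \<theta>(1) ..
      ultimately show ?thesis by (simp only: rest)
    next
      case 2
      then have e: "e = insert v (e - {u,v})" by auto
      have "(\<Prod>x\<in>e. g x) = g v * (\<Prod>x\<in>e-{u,v}. g x)" for g :: "_ \<Rightarrow> real"
        using fe by (subst e, subst prod.insert) auto
      moreover have "w1 v = 0" "w2 v = w u + w v" using uv(1) by (auto simp: w1_def w2_def)
      moreover have "w v * R = (1 - \<theta>) * ((w u + w v) * R)" for R
        unfolding mult.assoc[symmetric] \<theta>(2) ..
      ultimately show ?thesis by (simp only: rest)
    next
      case 3
      then have "e - {u,v} = e" by auto
      with rest show ?thesis by (simp add: algebra_simps)
    qed
  qed
  then have "wsum A w = \<theta> * wsum A w1 + (1 - \<theta>) * wsum A w2"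
    unfolding wsum_def by (simp add: sum_distrib_left flip: sum.distrib)
  then show ?thesis unfolding w1_def w2_def .
qed

text \<open>Each step moves all the weight of one of two non-adjacent vertices to the other and
  shrinks the support. The coefficients \<open>a\<close> and \<open>b\<close> may have any sign, because the sum over \<open>E\<close> and
  that over \<open>S\<close> are affine along the same segment.\<close>
lemma symmetrization:
  fixes w :: "'a \<Rightarrow> real" and a b :: real
  assumes V: "finite V" "\<And>e. e \<in> E \<Longrightarrow> e \<subseteq> V" "\<And>s. s \<in> S \<Longrightarrow> \<exists>e\<in>E. s \<subseteq> e"
    and w: "\<And>v. 0 \<le> w v" "sum w V = 1" "\<And>v. v \<notin> V \<Longrightarrow> w v = 0"
  obtains w' where "\<And>v. 0 \<le> w' v" "sum w' V = 1" "\<And>v. v \<notin> V \<Longrightarrow> w' v = 0"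
    "\<And>u v. u \<noteq> v \<Longrightarrow> w' u \<noteq> 0 \<Longrightarrow> w' v \<noteq> 0 \<Longrightarrow> adjacent E u v"
    "a * wsum E w + b * wsum S w \<le> a * wsum E w' + b * wsum S w'"
proof -
  define \<Phi> where "\<Phi> w = a * wsum E w + b * wsum S w" for w
  define ok where "ok w \<longleftrightarrow> (\<forall>v. 0 \<le> w v) \<and> sum w V = 1 \<and> (\<forall>v. v \<notin> V \<longrightarrow> w v = 0)" for w :: "'a \<Rightarrow> real"
  have "\<exists>w'. ok w' \<and> (\<forall>u v. u \<noteq> v \<and> w' u \<noteq> 0 \<and> w' v \<noteq> 0 \<longrightarrow> adjacent E u v) \<and> \<Phi> w \<le> \<Phi> w'"
    if "ok w" for w
    using that
  proof (induction "card {v\<in>V. w v \<noteq> 0}" arbitrary: w rule: less_induct)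
    case less
    show ?case
    proof (cases "\<forall>u v. u \<noteq> v \<and> w u \<noteq> 0 \<and> w v \<noteq> 0 \<longrightarrow> adjacent E u v")
      case True
      then show ?thesis using less.prems by auto
    next
      case False
      then obtain u v where uv: "u \<noteq> v" "w u \<noteq> 0" "w v \<noteq> 0" "\<not> adjacent E u v" by blast
      have ok: "\<And>x. 0 \<le> w x" "sum w V = 1" "\<And>x. x \<notin> V \<Longrightarrow> w x = 0"
        using less.prems by (auto simp: ok_def)
      have inV: "u \<in> V" "v \<in> V" using uv ok(3) by blast+
      have pos: "0 < w u" "0 < w v" using uv ok(1) by (simp_all add: order_less_le)
      define w1 where "w1 = w(u := w u + w v, v := 0)"
      define w2 where "w2 = w(u := 0, v := w u + w v)"
      define \<theta> where "\<theta> = w u / (w u + w v)"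
      have \<theta>: "0 \<le> \<theta>" "0 \<le> 1 - \<theta>" using pos by (simp_all add: \<theta>_def field_simps)
      have fE: "finite e" if "e \<in> E" for e by (rule finite_subset[OF V(2)[OF that] V(1)])
      have fS: "finite s" if "s \<in> S" for s using V(3)[OF that] fE finite_subset by blast
      have nS: "\<not> adjacent S u v"
      proof
        assume "adjacent S u v"
        then obtain s where "s \<in> S" "u \<in> s" "v \<in> s" unfolding adjacent_def by blast
        moreover obtain e where "e \<in> E" "s \<subseteq> e" using V(3)[OF \<open>s \<in> S\<close>] by blast
        ultimately show False using uv(4) unfolding adjacent_def by blast
      qed
      have ne: "w u + w v \<noteq> 0" using pos by linarith
      have conv: "\<Phi> w = \<theta> * \<Phi> w1 + (1 - \<theta>) * \<Phi> w2"
      proof -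
        have eqE: "wsum E w = \<theta> * wsum E w1 + (1 - \<theta>) * wsum E w2"
          unfolding w1_def w2_def \<theta>_def by (rule wsum_convex[OF fE uv(1) uv(4) ne])
        have eqS: "wsum S w = \<theta> * wsum S w1 + (1 - \<theta>) * wsum S w2"
          unfolding w1_def w2_def \<theta>_def by (rule wsum_convex[OF fS uv(1) nS ne])
        show ?thesis unfolding \<Phi>_def eqE eqS by (simp add: algebra_simps)
      qed
      have "\<Phi> w \<le> \<Phi> w1 \<or> \<Phi> w \<le> \<Phi> w2"
      proof (rule ccontr)
        assume neg: "\<not> ?thesis"
        have "\<theta> * \<Phi> w1 + (1 - \<theta>) * \<Phi> w2 < \<Phi> w"
        proof (rule convex_bound_lt)
        qed (use neg \<theta> in auto)
        then show False using conv by simp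
      qed
      moreover have part: "V = insert u (insert v (V - {u,v}))" using inV by auto
      have split: "sum g V = g u + g v + sum g (V - {u,v})" for g :: "'a \<Rightarrow> real"
        using V(1) uv(1) by (subst part) (simp add: insert_Diff_if)
      have "sum w1 (V - {u,v}) = sum w (V - {u,v})" "sum w2 (V - {u,v}) = sum w (V - {u,v})"
        by (auto simp: w1_def w2_def intro!: sum.cong)
      then have sums: "sum w1 V = 1" "sum w2 V = 1"
        using split[of w] split[of w1] split[of w2] ok(2) uv(1) by (auto simp: w1_def w2_def)
      have "ok w1" "ok w2"
        using ok sums inV by (auto simp: ok_def w1_def w2_def)
      moreover have "{x\<in>V. w1 x \<noteq> 0} \<subset> {x\<in>V. w x \<noteq> 0}"
        using uv inV by (auto simp: w1_def)
      then have "card {x\<in>V. w1 x \<noteq> 0} < card {x\<in>V. w x \<noteq> 0}"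
        using V(1) by (intro psubset_card_mono) auto
      moreover have "{x\<in>V. w2 x \<noteq> 0} \<subset> {x\<in>V. w x \<noteq> 0}"
        using uv inV by (auto simp: w2_def)
      then have "card {x\<in>V. w2 x \<noteq> 0} < card {x\<in>V. w x \<noteq> 0}"
        using V(1) by (intro psubset_card_mono) auto
      ultimately show ?thesis using less.hyps[of w1] less.hyps[of w2] order_trans by meson
    qed
  qed
  from this[of w] w obtain w' where "ok w'" "\<forall>u v. u \<noteq> v \<and> w' u \<noteq> 0 \<and> w' v \<noteq> 0 \<longrightarrow> adjacent E u v" "\<Phi> w \<le> \<Phi> w'"
    unfolding ok_def by blast
  then show ?thesis using that[of w'] unfolding ok_def \<Phi>_def by blast
qed

section \<open>Joint obstructions to several properties\<close>

definition induced :: "hypergraph \<Rightarrow> nat set \<Rightarrow> hypergraph" where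
  "induced H W = (W, {e\<in>edges H. e \<subseteq> W})"

text \<open>A homomorphism from \<open>F\<close> to \<open>G\<close>; it exists if and only if \<open>F\<close> is contained in a blow-up of \<open>G\<close>.\<close>
definition colourable :: "hypergraph \<Rightarrow> hypergraph \<Rightarrow> bool" where
  "colourable G F \<longleftrightarrow> (\<exists>h. h ` verts F \<subseteq> verts G \<and> (\<forall>e\<in>edges F. inj_on h e \<and> h ` e \<in> edges G))"

definition has_common_vertex :: "hypergraph \<Rightarrow> bool" where
  "has_common_vertex F \<longleftrightarrow> (\<exists>v. \<forall>e\<in>edges F. v \<in> e)"

definition monotone_property :: "(hypergraph \<Rightarrow> bool) \<Rightarrow> bool" where
  "monotone_property P \<longleftrightarrow> (\<forall>H F. triple_system H \<longrightarrow> triple_system F \<longrightarrow> contains H F \<longrightarrow> P H \<longrightarrow> P F)"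

definition locally_satisfies :: "nat \<Rightarrow> (hypergraph \<Rightarrow> bool) \<Rightarrow> hypergraph \<Rightarrow> bool" where
  "locally_satisfies m P H \<longleftrightarrow> (\<forall>W\<subseteq>verts H. card W \<le> m \<longrightarrow> P (induced H W))"

text \<open>Restricting the vertices to an initial segment makes the family finite; up to isomorphism it
  contains all obstructions with at most \<open>K\<close> vertices.\<close>
definition joint_obstructions :: "nat \<Rightarrow> (hypergraph \<Rightarrow> bool) set \<Rightarrow> hypergraph set" where
  "joint_obstructions K \<P> = {F. triple_system F \<and> verts F \<subseteq> {..<K} \<and> (\<forall>P\<in>\<P>. \<not> P F)}"

lemma triple_systemD:
  assumes "triple_system H"
  shows "finite (verts H)" "finite (edges H)" "\<And>e. e \<in> edges H \<Longrightarrow> e \<subseteq> verts H \<and> finite e \<and> card e = 3"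
proof -
  show f: "finite (verts H)" using assms by (simp add: r_graph_def)
  show "finite (edges H)" using assms finite_imp_finite_nsets[OF f] by (auto simp: r_graph_def intro: finite_subset)
  show "e \<subseteq> verts H \<and> finite e \<and> card e = 3" if "e \<in> edges H" for e
    using assms that by (auto simp: r_graph_def nsets_def)
qed

lemma triple_system_induced:
  assumes "triple_system H" "W \<subseteq> verts H" shows "triple_system (induced H W)"
  using triple_systemD[OF assms(1)] assms(2) finite_subset by (auto simp: r_graph_def induced_def nsets_def)

lemma colourable_monotone: "monotone_property (colourable G)"
  unfolding monotone_property_def
proof (intro allI impI)
  fix H F assume F: "triple_system F" and "contains H F" "colourable G H"
  then obtain f h where f: "inj_on f (verts F)" "f ` verts F \<subseteq> verts H" "\<forall>e\<in>edges F. f ` e \<in> edges H"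
    and h: "h ` verts H \<subseteq> verts G" "\<forall>e\<in>edges H. inj_on h e \<and> h ` e \<in> edges G"
    by (auto simp: contains_def colourable_def)
  have "inj_on (h \<circ> f) e" if "e \<in> edges F" for e
    using that f h triple_systemD(3)[OF F that] by (intro comp_inj_on) (auto intro: inj_on_subset)
  then show "colourable G F"
    unfolding colourable_def using f h
    by (intro exI[of _ "h \<circ> f"]) (simp add: image_image[symmetric] image_subset_iff)
qed

lemma common_vertex_monotone: "monotone_property has_common_vertex"
  unfolding monotone_property_def
proof (intro allI impI)
  fix H F assume F: "triple_system F" and "contains H F" "has_common_vertex H"
  then obtain f v where f: "inj_on f (verts F)" "\<forall>e\<in>edges F. f ` e \<in> edges H" and v: "\<forall>e\<in>edges H. v \<in> e"
    by (auto simp: contains_def has_common_vertex_def)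
  have "inv_into (verts F) f v \<in> e" if "e \<in> edges F" for e
  proof -
    have "v \<in> f ` e" "e \<subseteq> verts F" using that f v triple_systemD(3)[OF F] by auto
    then show ?thesis using f(1) by (auto simp: subset_iff)
  qed
  then show "has_common_vertex F" unfolding has_common_vertex_def by blast
qed

lemma finite_joint_obstructions: "finite (joint_obstructions K \<P>)"
proof (rule finite_subset)
  show "joint_obstructions K \<P> \<subseteq> Pow {..<K} \<times> Pow (Pow {..<K})"
    using triple_systemD(3) by (fastforce simp: joint_obstructions_def)
qed simp

lemma free_of_joint_obstructions:
  assumes "triple_system H" "P \<in> \<P>" "monotone_property P" "P H"
  shows "free_of (joint_obstructions K \<P>) H"
  using assms unfolding free_of_def joint_obstructions_def monotone_property_def by blast

text \<open>If every property fails on some part of \<open>H\<close> with at most \<open>m\<close> vertices, the union of these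
  parts has at most \<open>K\<close> vertices and violates all properties, so a copy of it is in the
  family.\<close>
lemma free_of_joint_obstructionsD:
  assumes H: "triple_system H" "free_of (joint_obstructions K \<P>) H"
    and \<P>: "finite \<P>" "\<And>P. P \<in> \<P> \<Longrightarrow> monotone_property P" "m * card \<P> \<le> K"
  obtains P where "P \<in> \<P>" "locally_satisfies m P H"
proof (rule ccontr)
  assume "\<not> thesis"
  with that have "\<forall>P\<in>\<P>. \<exists>W. W \<subseteq> verts H \<and> card W \<le> m \<and> \<not> P (induced H W)"
    unfolding locally_satisfies_def by blast
  then obtain W where W: "\<And>P. P \<in> \<P> \<Longrightarrow> W P \<subseteq> verts H" "\<And>P. P \<in> \<P> \<Longrightarrow> card (W P) \<le> m"
    "\<And>P. P \<in> \<P> \<Longrightarrow> \<not> P (induced H (W P))" by metis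
  define U where "U = (\<Union>P\<in>\<P>. W P)"
  have UH: "U \<subseteq> verts H" using W(1) by (auto simp: U_def)
  then have finU: "finite U" using triple_systemD(1)[OF H(1)] finite_subset by blast
  have "card U \<le> (\<Sum>P\<in>\<P>. card (W P))" unfolding U_def by (rule card_UN_le[OF \<P>(1)])
  also have "\<dots> \<le> (\<Sum>P\<in>\<P>. m)" by (intro sum_mono W(2))
  finally have cardU: "card U \<le> K" using \<P>(3) by (simp add: mult.commute)
  obtain g where g: "bij_betw g U {0..<card U}" using ex_bij_betw_finite_nat[OF finU] by blast
  define F where "F = (g ` U, image g ` {e\<in>edges H. e \<subseteq> U})"
  have ginj: "inj_on g U" and gU: "g ` U = {0..<card U}" using g by (auto simp: bij_betw_def)
  have tF: "triple_system F"
    using triple_systemD(3)[OF H(1)] finU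
    by (auto simp: r_graph_def F_def nsets_def card_image inj_on_subset[OF ginj])
  have inv: "inv_into U g ` g ` e = e" if "e \<subseteq> U" for e
    using ginj that by (rule inv_into_image_cancel)
  have "contains H F"
    unfolding contains_def
    using UH inv by (intro exI[of _ "inv_into U g"]) (auto simp: F_def inj_on_inv_into ginj)
  have "contains F (induced H (W P))" if "P \<in> \<P>" for P
  proof -
    have "W P \<subseteq> U" using that by (auto simp: U_def)
    then show ?thesis unfolding contains_def using ginj
      by (intro exI[of _ g]) (auto simp: F_def induced_def inj_on_subset)
  qed
  then have "\<not> P F" if "P \<in> \<P>" for P
    using \<P>(2)[OF that] W(1,3)[OF that] that tF triple_system_induced[OF H(1)] unfolding monotone_property_def by blast
  then have "F \<in> joint_obstructions K \<P>"
    using tF cardU gU by (auto simp: joint_obstructions_def F_def)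
  then show False using H(2) \<open>contains H F\<close> by (auto simp: free_of_def)
qed

text \<open>One edge and, for each of its three vertices, an edge avoiding that vertex together
  witness that there is no common vertex. They span at most 12 vertices.\<close>
lemma locally_has_common_vertex:
  assumes H: "triple_system H" and loc: "locally_satisfies m has_common_vertex H" and m: "12 \<le> m"
  shows "has_common_vertex H"
proof (rule ccontr)
  assume neg: "\<not> has_common_vertex H"
  then obtain e where e: "e \<in> edges H" unfolding has_common_vertex_def by blast
  obtain f where f: "\<And>v. f v \<in> edges H" "\<And>v. v \<notin> f v" using neg unfolding has_common_vertex_def by metis
  define W where "W = e \<union> (\<Union>v\<in>e. f v)"
  have ce: "finite e" "card e = 3" "W \<subseteq> verts H"
    using triple_systemD(3)[OF H] e f by (auto simp: W_def)
  have "card (\<Union>v\<in>e. f v) \<le> (\<Sum>v\<in>e. card (f v))" by (rule card_UN_le[OF ce(1)])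
  also have "\<dots> = 9" using triple_systemD(3)[OF H f(1)] ce by simp
  finally have "card W \<le> 12" unfolding W_def using card_Un_le[of e "\<Union>v\<in>e. f v"] ce by linarith
  then have "has_common_vertex (induced H W)" using loc m ce by (simp add: locally_satisfies_def)
  then obtain v where v: "\<And>x. x \<in> edges H \<Longrightarrow> x \<subseteq> W \<Longrightarrow> v \<in> x" by (auto simp: has_common_vertex_def induced_def)
  have "v \<in> e" using v[OF e] by (auto simp: W_def)
  then have "v \<in> f v" using v[OF f(1)[of v]] by (auto simp: W_def)
  then show False using f(2) by blast
qed

text \<open>For a set of at most \<open>n + 1\<close> vertices of the clique, add an edge through each pair of them. The
  result is a small part of \<open>H\<close>, and its homomorphism to \<open>G\<close> is injective on the chosen vertices,
  since any two of them lie in an edge. Thus there cannot be \<open>n + 1\<close> of them, and the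
  argument applies to the whole clique.\<close>
lemma clique_embeds:
  assumes H: "triple_system H" and fin: "finite (verts G)" "card (verts G) = n"
    and loc: "locally_satisfies m (colourable G) H" and m: "(n + 1) + 3 * (n + 1)^2 \<le> m"
    and U: "U \<subseteq> verts H" "\<And>u v. u \<in> U \<Longrightarrow> v \<in> U \<Longrightarrow> u \<noteq> v \<Longrightarrow> adjacent (edges H) u v"
  obtains h where "inj_on h U" "h ` U \<subseteq> verts G" "\<And>e. e \<in> edges H \<Longrightarrow> e \<subseteq> U \<Longrightarrow> h ` e \<in> edges G"
proof -
  have finU: "finite U" using U(1) triple_systemD(1)[OF H] finite_subset by blast
  have small: "\<exists>h. inj_on h U' \<and> h ` U' \<subseteq> verts G \<and> (\<forall>e\<in>edges H. e \<subseteq> U' \<longrightarrow> h ` e \<in> edges G)"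
    if U': "U' \<subseteq> U" "card U' \<le> n + 1" for U'
  proof -
    have "\<exists>e. u \<in> U' \<and> v \<in> U' \<and> u \<noteq> v \<longrightarrow> e \<in> edges H \<and> u \<in> e \<and> v \<in> e" for u v
    proof (cases "u \<in> U' \<and> v \<in> U' \<and> u \<noteq> v")
      case True
      then have "adjacent (edges H) u v" using U'(1) by (intro U(2)) auto
      then show ?thesis unfolding adjacent_def by blast
    qed auto
    then have "\<exists>f'. \<forall>u v. u \<in> U' \<and> v \<in> U' \<and> u \<noteq> v \<longrightarrow> f' u v \<in> edges H \<and> u \<in> f' u v \<and> v \<in> f' u v"
      by (intro choice allI)
    then obtain f' where f': "\<And>u v. u \<in> U' \<and> v \<in> U' \<and> u \<noteq> v \<longrightarrow> f' u v \<in> edges H \<and> u \<in> f' u v \<and> v \<in> f' u v"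
      by blast
    define f where "f p = f' (fst p) (snd p)" for p
    define Q where "Q = {p\<in>U'\<times>U'. fst p \<noteq> snd p}"
    define W where "W = U' \<union> (\<Union>p\<in>Q. f p)"
    have "finite U'" using finU U' finite_subset by blast
    moreover have "Q \<subseteq> U' \<times> U'" by (auto simp: Q_def)
    ultimately have fin': "finite U'" "finite Q" using finite_subset by blast+
    have fQ: "f p \<in> edges H" "fst p \<in> f p" "snd p \<in> f p" if "p \<in> Q" for p
      using f'[of "fst p" "snd p"] that by (auto simp: Q_def f_def)
    have "card (\<Union>p\<in>Q. f p) \<le> (\<Sum>p\<in>Q. card (f p))" by (rule card_UN_le[OF fin'(2)])
    also have "\<dots> = 3 * card Q" using triple_systemD(3)[OF H fQ(1)] by simp
    finally have cardUN: "card (\<Union>p\<in>Q. f p) \<le> 3 * card Q" .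
    have "card Q \<le> card (U' \<times> U')" using fin' by (intro card_mono) (auto simp: Q_def)
    also have "\<dots> \<le> (n + 1)^2"
      using U'(2) by (simp only: card_cartesian_product power2_eq_square mult_mono)
    finally have "card Q \<le> (n + 1)^2" .
    with cardUN U'(2) have "card W \<le> (n + 1) + 3 * (n + 1)^2"
      unfolding W_def using card_Un_le[of U' "\<Union>p\<in>Q. f p"] by linarith
    moreover have "W \<subseteq> verts H" using U(1) U'(1) triple_systemD(3)[OF H] fQ(1) unfolding W_def by blast
    ultimately have "colourable G (induced H W)" using loc m by (simp add: locally_satisfies_def)
    then obtain h where h: "h ` W \<subseteq> verts G" "\<And>e. e \<in> edges H \<Longrightarrow> e \<subseteq> W \<Longrightarrow> inj_on h e \<and> h ` e \<in> edges G"
      by (auto simp: colourable_def induced_def)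
    have "inj_on h U'"
    proof (rule inj_onI)
      fix x y assume xy: "x \<in> U'" "y \<in> U'" "h x = h y"
      show "x = y"
      proof (rule ccontr)
        assume "x \<noteq> y"
        then have p: "(x, y) \<in> Q" using xy by (auto simp: Q_def)
        then have "f (x, y) \<subseteq> W" by (auto simp: W_def)
        then have "inj_on h (f (x, y))" using h fQ(1)[OF p] by blast
        then show False using xy \<open>x \<noteq> y\<close> fQ(2,3)[OF p] by (auto dest: inj_onD)
      qed
    qed
    moreover have "U' \<subseteq> W" by (auto simp: W_def)
    then have "h ` U' \<subseteq> verts G" "\<forall>e\<in>edges H. e \<subseteq> U' \<longrightarrow> h ` e \<in> edges G"
      using h by (blast, meson order_trans)
    ultimately show ?thesis by blast
  qed
  have "card U \<le> n"
  proof (rule ccontr)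
    assume "\<not> card U \<le> n"
    then obtain U' where U': "U' \<subseteq> U" "card U' = n + 1"
      using obtain_subset_with_card_n[of "n+1" U] by auto
    then obtain h where "inj_on h U'" "h ` U' \<subseteq> verts G" using small[of U'] by auto
    then have "card U' \<le> card (verts G)" using card_inj_on_le fin by blast
    then show False using U' fin by simp
  qed
  then show ?thesis using small[of U] that by auto
qed

section \<open>Edge and shadow densities of triple systems that map locally to a pattern\<close>

text \<open>The left-hand side is the polynomial \<open>a p\<^sub>H + b q\<close> at the uniform weights on \<open>H\<close>. After
  symmetrization the weights sit on a clique of the shadow, where \<open>q\<close> is
  determined by the sum of squares, and the embedding of the clique carries them to \<open>G\<close>.\<close>
lemma lagrangian_transfer:
  fixes a b :: real
  assumes H: "triple_system H" and G: "finite (verts G)" "finite (edges G)" "\<And>e. e \<in> edges G \<Longrightarrow> e \<subseteq> verts G"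
    and n: "card (verts G) = n"
    and loc: "locally_satisfies m (colourable G) H" and m: "(n + 1) + 3 * (n + 1)^2 \<le> m"
    and N: "N = card (verts H)" "0 < N" and a: "0 \<le> a"
  obtains y :: "nat \<Rightarrow> real" where "\<And>i. 0 \<le> y i" "sum y (verts G) = 1"
    "a * card (edges H) / N^3 + b * card (edges (shadow 3 H)) / N^2
      \<le> a * wsum (edges G) y + b * (1 - (\<Sum>i\<in>verts G. (y i)^2)) / 2"
proof -
  define V E S where "V = verts H" and "E = edges H" and "S = edges (shadow 3 H)"
  have finV: "finite V" and finE: "finite E" and E: "\<And>e. e \<in> E \<Longrightarrow> e \<subseteq> V \<and> finite e \<and> card e = 3"
    using triple_systemD[OF H] by (auto simp: V_def E_def)
  have S: "S = {s \<in> nsets V 2. \<exists>e\<in>E. s \<subseteq> e}" by (simp add: S_def shadow_def V_def E_def)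
  have finS: "finite S" using S finV finite_imp_finite_nsets[of V 2] by simp
  define w0 where "w0 v = (if v \<in> V then 1 / real N else 0)" for v
  have unif: "wsum A w0 = card A / N^k" if "\<And>e. e \<in> A \<Longrightarrow> e \<subseteq> V \<and> card e = k" for A k
  proof -
    have "(\<Prod>v\<in>e. w0 v) = (1 / real N)^k" if "e \<in> A" for e
    proof -
      have "(\<Prod>v\<in>e. w0 v) = (\<Prod>v\<in>e. 1 / real N)"
        using \<open>\<And>e. e \<in> A \<Longrightarrow> e \<subseteq> V \<and> card e = k\<close>[OF that] by (intro prod.cong) (auto simp: w0_def)
      then show ?thesis using \<open>\<And>e. e \<in> A \<Longrightarrow> e \<subseteq> V \<and> card e = k\<close>[OF that] by simp
    qed
    then show ?thesis by (simp add: wsum_def power_one_over)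
  qed
  have w0: "\<And>v. 0 \<le> w0 v" "sum w0 V = 1" "\<And>v. v \<notin> V \<Longrightarrow> w0 v = 0"
    using N by (auto simp: w0_def V_def)
  have EV: "e \<subseteq> V" if "e \<in> E" for e using E[OF that] by blast
  have SE: "\<exists>e\<in>E. s \<subseteq> e" if "s \<in> S" for s using that S by blast
  obtain w where w: "\<And>v. 0 \<le> w v" "sum w V = 1" "\<And>v. v \<notin> V \<Longrightarrow> w v = 0"
    and adj: "\<And>u v. u \<noteq> v \<Longrightarrow> w u \<noteq> 0 \<Longrightarrow> w v \<noteq> 0 \<Longrightarrow> adjacent E u v"
    and le: "a * wsum E w0 + b * wsum S w0 \<le> a * wsum E w + b * wsum S w"
    by (rule symmetrization[of V E S w0 a b]; (rule that)?) (assumption | rule finV EV SE w0)+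
  define U where "U = {v\<in>V. w v \<noteq> 0}"
  have UV: "U \<subseteq> V" and finU: "finite U" using finV by (auto simp: U_def)
  have wU: "w v = 0" if "v \<notin> U" for v using that w(3) by (auto simp: U_def)
  have Uadj: "adjacent (edges H) u v" if "u \<in> U" "v \<in> U" "u \<noteq> v" for u v
    using adj[of u v] that by (simp add: U_def E_def)
  obtain h where h: "inj_on h U" "h ` U \<subseteq> verts G" "\<And>e. e \<in> E \<Longrightarrow> e \<subseteq> U \<Longrightarrow> h ` e \<in> edges G"
    using clique_embeds[OF H G(1) n loc m UV[unfolded V_def] Uadj] unfolding E_def by blast
  define y where "y i = (if i \<in> h ` U then w (inv_into U h i) else 0)" for i
  have yh: "y (h u) = w u" if "u \<in> U" for u using that h(1) by (simp add: y_def)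
  have ynn: "0 \<le> y i" for i using w(1) by (simp add: y_def)
  have push: "(\<Sum>i\<in>verts G. g (y i)) = (\<Sum>u\<in>U. g (w u))" if "g 0 = 0" for g :: "real \<Rightarrow> real"
  proof -
    have "(\<Sum>i\<in>verts G. g (y i)) = (\<Sum>i\<in>h ` U. g (y i))"
      using h(2) G(1) that by (intro sum.mono_neutral_right) (auto simp: y_def)
    also have "\<dots> = (\<Sum>u\<in>U. g (w u))" using yh by (simp add: sum.reindex[OF h(1)])
    finally show ?thesis .
  qed
  have sumU: "sum w U = 1"
    using w(2) UV finV wU by (metis (mono_tags, lifting) DiffE sum.mono_neutral_right)
  have vanish: "wsum A w = wsum {e\<in>A. e \<subseteq> U} w" if "finite A" "\<And>e. e \<in> A \<Longrightarrow> finite e" for A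
    unfolding wsum_def using that wU by (intro sum.mono_neutral_right) (auto simp: prod_zero_iff)
  have "wsum E w = wsum {e\<in>E. e \<subseteq> U} w" using finE E by (intro vanish) auto
  also have "\<dots> = wsum (image h ` {e\<in>E. e \<subseteq> U}) y"
  proof -
    have "inj_on (image h) {e\<in>E. e \<subseteq> U}"
      by (rule inj_on_subset[OF inj_on_image_Pow[OF h(1)]]) auto
    moreover have "(\<Prod>i\<in>h ` e. y i) = (\<Prod>u\<in>e. w u)" if "e \<subseteq> U" for e
      using that yh inj_on_subset[OF h(1) that] by (subst prod.reindex) (auto intro!: prod.cong)
    ultimately show ?thesis unfolding wsum_def by (simp add: sum.reindex)
  qed
  also have "\<dots> \<le> wsum (edges G) y"
    unfolding wsum_def using h(3) G(2) ynn by (intro sum_mono2 prod_nonneg) auto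
  finally have EG: "wsum E w \<le> wsum (edges G) y" .
  have "wsum S w = wsum {s\<in>S. s \<subseteq> U} w" using finS S by (intro vanish) (auto simp: nsets_def)
  also have "{s\<in>S. s \<subseteq> U} = nsets U 2"
  proof (intro equalityI subsetI)
    fix s assume "s \<in> nsets U 2"
    then obtain u v where s: "s = {u, v}" "u \<noteq> v" "u \<in> U" "v \<in> U" by (auto simp: nsets_def card_2_iff)
    then obtain e where "e \<in> E" "u \<in> e" "v \<in> e" using adj[of u v] by (auto simp: U_def adjacent_def)
    then show "s \<in> {s\<in>S. s \<subseteq> U}" using s UV by (auto simp: S nsets_def)
  qed (auto simp: S nsets_def)
  finally have SG: "wsum S w = (1 - (\<Sum>i\<in>verts G. (y i)^2)) / 2"
    using wsum_nsets_2[OF finU, of w] sumU push[of "\<lambda>x. x^2"] by simp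
  have "wsum E w0 = card E / N^3" using E by (intro unif) auto
  moreover have "wsum S w0 = card S / N^2" by (intro unif) (auto simp: S nsets_def)
  ultimately have "a * card E / N^3 + b * card S / N^2 \<le> a * wsum (edges G) y + b * (1 - (\<Sum>i\<in>verts G. (y i)^2)) / 2"
    using le SG mult_left_mono[OF EG a] by simp
  moreover have "sum y (verts G) = 1" using push[of "\<lambda>x. x"] sumU by simp
  ultimately show ?thesis using that[of y] ynn unfolding E_def S_def by simp
qed

lemma sum_squares_ge:
  fixes y :: "'a \<Rightarrow> real"
  assumes "finite V" "card V = n" "0 < n" "sum y V = 1"
  shows "1 / n \<le> (\<Sum>v\<in>V. (y v)^2)"
proof -
  have "0 \<le> (\<Sum>v\<in>V. (y v - 1 / n)^2)" by (simp add: sum_nonneg)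
  also have "\<dots> = (\<Sum>v\<in>V. (y v)^2 - 2 / n * y v + (1 / n)^2)"
    by (intro sum.cong refl) (simp add: power2_eq_square algebra_simps)
  also have "\<dots> = (\<Sum>v\<in>V. (y v)^2) - 2 / n * sum y V + n * (1 / n)^2"
    by (simp only: sum.distrib sum_subtractf sum_distrib_left[symmetric] sum_constant assms)
  also have "\<dots> = (\<Sum>v\<in>V. (y v)^2) - 1 / n" using assms by (simp add: power2_eq_square)
  finally show ?thesis by simp
qed

text \<open>The number \<open>\<alpha>\<close> is six times the value of the Lagrangian polynomial at the uniform weights. The
  quadratic deficit makes the uniform weights its only maximiser, in a quantitative form that
  yields stability of the shadow.\<close>
definition uniform_pattern :: "real \<Rightarrow> nat \<Rightarrow> hypergraph \<Rightarrow> bool" where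
  "uniform_pattern \<alpha> n G \<longleftrightarrow> triple_system G \<and> verts G = {..<n} \<and> 0 < n \<and> 6 * real (card (edges G)) = \<alpha> * n^3 \<and>
     (\<forall>y. (\<forall>i. 0 \<le> y i) \<longrightarrow> sum y {..<n} = 1 \<longrightarrow>
        6 * wsum (edges G) y \<le> \<alpha> - ((\<Sum>i<n. (y i)^2) - 1 / n) / 2)"

text \<open>The coefficients of the edge and shadow polynomials are \<open>(1, 0)\<close>, \<open>(0, 1)\<close> and \<open>(6, -1)\<close>. In the
  third case the sum of squares in the shadow term cancels the quadratic deficit of the
  pattern.\<close>
lemma uniform_pattern_bounds:
  assumes G: "uniform_pattern \<alpha> n G" and H: "triple_system H" "locally_satisfies m (colourable G) H"
    and m: "(n + 1) + 3 * (n + 1)^2 \<le> m" and N: "N = card (verts H)" "0 < N"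
  shows "6 * (card (edges H) / real N ^ 3) \<le> \<alpha>"
    and "2 * (card (edges (shadow 3 H)) / real N ^ 2) \<le> 1 - 1 / n"
    and "6 * (card (edges H) / real N ^ 3) - card (edges (shadow 3 H)) / real N ^ 2 \<le> \<alpha> - (1 - 1 / n) / 2"
proof -
  let ?e = "card (edges H) / real N ^ 3" and ?s = "card (edges (shadow 3 H)) / real N ^ 2"
  have vG: "verts G = {..<n}" "0 < n" and tG: "triple_system G" using G by (auto simp: uniform_pattern_def)
  have "finite (verts G)" "finite (edges G)" "\<And>e. e \<in> edges G \<Longrightarrow> e \<subseteq> verts G" "card (verts G) = n"
    using triple_systemD[OF tG] vG by auto
  note transfer = lagrangian_transfer[OF H(1) this H(2) m N]
  have bnd: "6 * wsum (edges G) y \<le> \<alpha> - ((\<Sum>i<n. (y i)^2) - 1 / n) / 2" "1 / n \<le> (\<Sum>i<n. (y i)^2)"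
    if "\<And>i. 0 \<le> y i" "sum y (verts G) = 1" for y
    using G that sum_squares_ge[of "{..<n}" n y] by (simp_all add: uniform_pattern_def)
  obtain y where "\<And>i. 0 \<le> y i" "sum y (verts G) = 1" "?e \<le> wsum (edges G) y"
    using transfer[of 1 0] by auto
  with bnd[of y] show "6 * ?e \<le> \<alpha>" by argo
  obtain y where "\<And>i. 0 \<le> y i" "sum y (verts G) = 1" "?s \<le> (1 - (\<Sum>i<n. (y i)^2)) / 2"
    using transfer[of 0 1] vG by auto
  with bnd[of y] show "2 * ?s \<le> 1 - 1 / n" by argo
  obtain y where "\<And>i. 0 \<le> y i" "sum y (verts G) = 1"
    "6 * ?e - ?s \<le> 6 * wsum (edges G) y + ((\<Sum>i<n. (y i)^2) - 1) / 2"
    using transfer[of 6 "-1"] vG by auto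
  with bnd[of y] show "6 * ?e - ?s \<le> \<alpha> - (1 - 1 / n) / 2" by argo
qed

section \<open>Normalisation of densities\<close>

lemma real_choose_2: "real (n choose 2) = real n * (real n - 1) / 2"
  by (simp add: binomial_gbinomial gbinomial_prod_rev numeral_2_eq_2)

lemma real_choose_3: "real (n choose 3) = real n * (real n - 1) * (real n - 2) / 6"
  by (simp add: binomial_gbinomial gbinomial_prod_rev numeral_3_eq_3 fact_numeral algebra_simps)

lemma choose_ratio_tendsto:
  assumes "r = 2 \<or> r = 3"
  shows "(\<lambda>n. real (n choose r) / real n ^ r) \<longlonglongrightarrow> 1 / fact r"
proof -
  have "(\<lambda>n. real n * (real n - 1) / 2 / real n ^ 2) \<longlonglongrightarrow> 1 / 2" by real_asymp
  moreover have "(\<lambda>n. real n * (real n - 1) * (real n - 2) / 6 / real n ^ 3) \<longlonglongrightarrow> 1 / 6" by real_asymp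
  ultimately show ?thesis using assms
    by (auto simp: real_choose_2 real_choose_3 fact_numeral)
qed

lemma density_tendsto_iff:
  assumes N: "filterlim (\<lambda>k. card (verts (H k))) at_top sequentially" and r: "r = 2 \<or> r = 3"
  shows "(\<lambda>k. density r (H k)) \<longlonglongrightarrow> y \<longleftrightarrow>
    (\<lambda>k. fact r * (card (edges (H k)) / real (card (verts (H k))) ^ r)) \<longlonglongrightarrow> y"
proof -
  let ?N = "\<lambda>k. card (verts (H k))"
  let ?c = "\<lambda>k. fact r * (real (?N k choose r) / real (?N k) ^ r)"
  have c: "?c \<longlonglongrightarrow> 1"
    using tendsto_mult[OF tendsto_const[of "fact r"] filterlim_compose[OF choose_ratio_tendsto[OF r] N]]
    by simp
  have ev: "\<forall>\<^sub>F k in sequentially. 0 < real (?N k choose r) \<and> 0 < ?N k"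
  proof (rule eventually_mono)
    show "\<forall>\<^sub>F k in sequentially. 3 \<le> ?N k" using N by (simp add: filterlim_at_top)
  qed (use r in \<open>auto intro!: zero_less_binomial\<close>)
  have eq: "\<forall>\<^sub>F k in sequentially. fact r * (card (edges (H k)) / real (?N k) ^ r) = density r (H k) * ?c k"
    using ev by eventually_elim (simp add: density_def)
  have eq': "\<forall>\<^sub>F k in sequentially. density r (H k) = fact r * (card (edges (H k)) / real (?N k) ^ r) / ?c k"
    using ev by eventually_elim (simp add: density_def)
  show ?thesis
  proof
    assume "(\<lambda>k. density r (H k)) \<longlonglongrightarrow> y"
    then have "(\<lambda>k. density r (H k) * ?c k) \<longlonglongrightarrow> y * 1" using c by (rule tendsto_mult)
    then show "(\<lambda>k. fact r * (card (edges (H k)) / real (?N k) ^ r)) \<longlonglongrightarrow> y"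
      unfolding tendsto_cong[OF eq] by simp
  next
    assume "(\<lambda>k. fact r * (card (edges (H k)) / real (?N k) ^ r)) \<longlonglongrightarrow> y"
    then have "(\<lambda>k. fact r * (card (edges (H k)) / real (?N k) ^ r) / ?c k) \<longlonglongrightarrow> y / 1"
      using c by (rule tendsto_divide) simp
    then show "(\<lambda>k. density r (H k)) \<longlonglongrightarrow> y" unfolding tendsto_cong[OF eq'] by simp
  qed
qed

section \<open>Constructions\<close>

text \<open>The vertices of residue \<open>i\<close> modulo \<open>n\<close> are the \<open>k\<close> copies of the vertex \<open>i\<close> of \<open>G\<close>.\<close>
definition blowup :: "nat \<Rightarrow> hypergraph \<Rightarrow> nat \<Rightarrow> hypergraph" where
  "blowup n G k = ({..<n * k}, {T \<in> nsets {..<n * k} 3. inj_on (\<lambda>v. v mod n) T \<and> (\<lambda>v. v mod n) ` T \<in> edges G})"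

lemma blowup_colourable:
  assumes "verts G = {..<n}" "0 < n"
  shows "triple_system (blowup n G k)" "colourable G (blowup n G k)"
proof -
  show "triple_system (blowup n G k)" by (simp add: blowup_def r_graph_def subset_iff)
  show "colourable G (blowup n G k)"
    unfolding colourable_def blowup_def fst_conv snd_conv assms(1)
    using assms(2) by (intro exI[of _ "\<lambda>v. v mod n"]) (simp add: image_subset_iff)
qed

lemma card_blowup_ge:
  assumes G: "triple_system G" "verts G = {..<n}" "0 < n"
  shows "card (edges G) * k^3 \<le> card (edges (blowup n G k))"
proof -
  define \<Psi> where "\<Psi> p = (\<lambda>i. i + n * snd p i) ` fst p" for p :: "nat set \<times> (nat \<Rightarrow> nat)"
  let ?A = "SIGMA e:edges G. PiE e (\<lambda>_. {..<k})"
  have e: "finite e" "card e = 3" "\<And>i. i \<in> e \<Longrightarrow> i < n" if "e \<in> edges G" for e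
    using triple_systemD(3)[OF G(1) that] G(2) by auto
  have modn: "(i + n * j) mod n = i" if "i < n" for i j using that by simp
  have residues_\<Psi>: "(\<lambda>v. v mod n) ` \<Psi> (e, f) = e" if "e \<in> edges G" for e f
    using e(3)[OF that] by (force simp: \<Psi>_def image_image)
  have "card ?A = (\<Sum>e\<in>edges G. card (PiE e (\<lambda>_. {..<k})))"
    using triple_systemD(2)[OF G(1)] e(1) by (intro card_SigmaI ballI finite_PiE) auto
  also have "\<dots> = (\<Sum>e\<in>edges G. k^3)"
    using e by (intro sum.cong refl) (simp add: card_PiE)
  finally have cardA: "card ?A = card (edges G) * k^3" by simp
  have inj: "inj_on \<Psi> ?A"
  proof (rule inj_onI, clarify)
    fix e f e' f' assume *: "e \<in> edges G" "f \<in> PiE e (\<lambda>_. {..<k})" "e' \<in> edges G" "f' \<in> PiE e' (\<lambda>_. {..<k})"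
      "\<Psi> (e, f) = \<Psi> (e', f')"
    have ee: "e = e'" using residues_\<Psi>[OF *(1), of f] residues_\<Psi>[OF *(3), of f'] *(5) by simp
    have "f i = f' i" if "i \<in> e" for i
    proof -
      have "i + n * f i \<in> \<Psi> (e', f')" using that *(5) by (auto simp: \<Psi>_def)
      then obtain j where j: "j \<in> e'" "i + n * f i = j + n * f' j" by (auto simp: \<Psi>_def)
      then have "i = j" using modn[of i "f i"] modn[of j "f' j"] e(3)[OF *(1) that] e(3)[OF *(3) j(1)] by simp
      then show ?thesis using j(2) G(3) by simp
    qed
    then show "e = e' \<and> f = f'" using ee *(2,4) PiE_ext by metis
  qed
  have sub: "\<Psi> ` ?A \<subseteq> edges (blowup n G k)"
  proof clarify
    fix e f assume *: "e \<in> edges G" "f \<in> PiE e (\<lambda>_. {..<k})"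
    let ?g = "\<lambda>i. i + n * f i"
    have inj_g: "inj_on ?g e"
      using modn e(3)[OF *(1)] by (intro inj_onI) metis
    have "?g i < n * k" if "i \<in> e" for i
    proof -
      have "f i < k" using *(2) that by auto
      then have "n * (f i + 1) \<le> n * k" by (intro mult_le_mono2) simp
      then show ?thesis using e(3)[OF *(1) that] by simp
    qed
    then have "\<Psi> (e, f) \<in> nsets {..<n * k} 3"
      using e[OF *(1)] inj_g by (auto simp: \<Psi>_def nsets_def card_image)
    moreover have "inj_on (\<lambda>v. v mod n) (\<Psi> (e, f))"
      using modn e(3)[OF *(1)] by (auto simp: \<Psi>_def intro!: inj_onI)
    ultimately show "\<Psi> (e, f) \<in> edges (blowup n G k)"
      using residues_\<Psi>[OF *(1)] *(1) by (simp add: blowup_def)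
  qed
  have "finite (edges (blowup n G k))"
    using triple_systemD(2)[OF blowup_colourable(1)[OF G(2,3)]] .
  then show ?thesis using card_inj_on_le[OF inj sub] cardA by simp
qed

lemma monotone_imp_locally:
  assumes "triple_system H" "monotone_property P" "P H"
  shows "locally_satisfies m P H"
  unfolding locally_satisfies_def
proof (intro allI impI)
  fix W assume W: "W \<subseteq> verts H"
  have "contains H (induced H W)"
    using W unfolding contains_def by (intro exI[of _ id]) (auto simp: induced_def)
  then show "P (induced H W)"
    using assms triple_system_induced[OF assms(1) W] unfolding monotone_property_def by blast
qed

lemma feasible_regionI:
  assumes "x \<in> {0..1}" "y \<in> {0..1}" "\<And>k. r_graph r (H k)" "\<And>k. free_of \<F> (H k)"
    "filterlim (\<lambda>k. card (verts (H k))) at_top sequentially"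
    "(\<lambda>k. density (r - 1) (shadow r (H k))) \<longlonglongrightarrow> x" "(\<lambda>k. density r (H k)) \<longlonglongrightarrow> y"
  shows "(x, y) \<in> feasible_region r \<F>"
  unfolding feasible_region_def mem_Collect_eq case_prod_conv using assms by (intro conjI exI[of _ H]) simp_all

text \<open>The blow-ups have edge density exactly \<open>\<alpha>\<close> after normalisation by \<open>N\<^sup>3/6\<close>. The general
  bounds then determine their shadows, with no further count.\<close>
lemma uniform_pattern_attained:
  assumes G: "uniform_pattern \<alpha> n G" "0 \<le> \<alpha>" "\<alpha> \<le> 1"
    and free: "\<And>H. triple_system H \<Longrightarrow> colourable G H \<Longrightarrow> free_of \<F> H"
  shows "(1 - 1 / n, \<alpha>) \<in> feasible_region 3 \<F>"
proof -
  have vG: "verts G = {..<n}" "0 < n" and tG: "triple_system G" and cG: "6 * real (card (edges G)) = \<alpha> * n^3"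
    using G by (auto simp: uniform_pattern_def)
  define H where "H k = blowup n G (Suc k)" for k
  let ?N = "\<lambda>k. card (verts (H k))"
  let ?s = "\<lambda>k. card (edges (shadow 3 (H k))) / real (?N k)^2"
  have H: "triple_system (H k)" "colourable G (H k)" for k
    using blowup_colourable[OF vG] by (auto simp: H_def)
  have Nk: "?N k = n * Suc k" for k by (simp add: H_def blowup_def)
  have Npos: "0 < ?N k" for k using vG Nk by simp
  note bounds = uniform_pattern_bounds[OF G(1) H(1) monotone_imp_locally[OF H(1) colourable_monotone H(2)] order_refl refl Npos]
  have eq: "6 * (card (edges (H k)) / real (?N k)^3) = \<alpha>" for k
  proof (rule antisym)
    have "\<alpha> * n^3 * Suc k^3 = 6 * real (card (edges G) * Suc k^3)" using cG by simp
    also have "\<dots> \<le> 6 * real (card (edges (H k)))"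
      using card_blowup_ge[OF tG vG, of "Suc k"] unfolding H_def by (intro mult_left_mono of_nat_mono) auto
    finally show "\<alpha> \<le> 6 * (card (edges (H k)) / real (?N k)^3)"
      using vG by (simp add: Nk field_simps power_mult_distrib del: of_nat_Suc mult_Suc_right)
  qed (rule bounds(1))
  have "2 * ?s k = 1 - 1 / n" for k
    using bounds(2,3)[of k] eq[of k] by argo
  moreover have "filterlim ?N at_top sequentially"
  proof (rule filterlim_at_top_mono[OF filterlim_ident])
    show "\<forall>\<^sub>F k in sequentially. k \<le> ?N k"
      using vG by (intro always_eventually allI) (simp add: Nk trans_le_add2)
  qed
  then have lim: "filterlim ?N at_top sequentially" "filterlim (\<lambda>k. card (verts (shadow 3 (H k)))) at_top sequentially"
    by (simp_all add: shadow_def)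
  moreover have "(\<lambda>k. density 3 (H k)) \<longlonglongrightarrow> \<alpha>"
    using density_tendsto_iff[OF lim(1), of 3 \<alpha>] eq by (simp add: fact_numeral)
  moreover have "(\<lambda>k. density (3 - 1) (shadow 3 (H k))) \<longlonglongrightarrow> 1 - 1 / n"
    using density_tendsto_iff[OF lim(2), of 2 "1 - 1 / n"] \<open>\<And>k. 2 * ?s k = 1 - 1 / n\<close>
    by (simp add: fact_numeral shadow_def)
  moreover have "1 - 1 / real n \<in> {0..1}" using vG by simp
  ultimately show ?thesis
    using G(2,3) H free by (intro feasible_regionI[where H = H]) auto
qed

definition star :: "nat \<Rightarrow> nat \<Rightarrow> hypergraph" where
  "star N m = ({..<N}, {e \<in> nsets {..<m} 3. 0 \<in> e})"

lemma common_vertex_card_le: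
  assumes H: "triple_system H" "has_common_vertex H"
  shows "card (edges H) \<le> (card (verts H))^2"
proof -
  obtain v where v: "\<And>e. e \<in> edges H \<Longrightarrow> v \<in> e" using H(2) by (auto simp: has_common_vertex_def)
  have "inj_on (\<lambda>e. e - {v}) (edges H)" using v by (auto intro!: inj_onI)
  moreover have "(\<lambda>e. e - {v}) ` edges H \<subseteq> nsets (verts H) 2"
    using triple_systemD(3)[OF H(1)] v by (auto simp: nsets_def card_Diff_singleton)
  moreover have "finite (nsets (verts H) 2)" using triple_systemD(1)[OF H(1)] finite_imp_finite_nsets by blast
  ultimately have "card (edges H) \<le> card (nsets (verts H) 2)" by (rule card_inj_on_le)
  also have "\<dots> = card (verts H) choose 2" by (rule card_nsets)
  also have "\<dots> \<le> (card (verts H))^2" by (simp add: binomial_le_pow2 power2_eq_square choose_two div_le_dividend mult_le_mono order_trans[OF div_le_dividend])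
  finally show ?thesis .
qed

lemma star_basic:
  assumes "m \<le> N" shows "triple_system (star N m)" "has_common_vertex (star N m)"
  using assms by (auto simp: star_def r_graph_def nsets_def has_common_vertex_def)

lemma edges_shadow_star:
  assumes "3 \<le> m" "m \<le> N"
  shows "edges (shadow 3 (star N m)) = nsets {..<m} 2"
proof (intro equalityI subsetI)
  fix s assume "s \<in> edges (shadow 3 (star N m))"
  then show "s \<in> nsets {..<m} 2" by (auto simp: shadow_def star_def nsets_def)
next
  fix s assume s: "s \<in> nsets {..<m} 2"
  then have fs: "finite s" "card s = 2" "s \<subseteq> {..<m}" by (auto simp: nsets_def)
  have "\<exists>c. c < m \<and> c \<notin> s \<and> 0 \<in> insert c s"
  proof (cases "0 \<in> s")
    case True
    have "\<not> {..<m} \<subseteq> s" using card_mono[OF fs(1), of "{..<m}"] fs(2) assms(1) by auto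
    then show ?thesis using True by blast
  qed (use assms in auto)
  then obtain c where c: "c < m" "c \<notin> s" "0 \<in> insert c s" by blast
  then have "insert c s \<in> edges (star N m)" using fs by (auto simp: star_def nsets_def)
  moreover have "s \<subseteq> insert c s" by blast
  ultimately have "\<exists>e\<in>edges (star N m). s \<subseteq> e" by blast
  then show "s \<in> edges (shadow 3 (star N m))"
    using fs assms(2) by (auto simp: shadow_def star_def nsets_def)
qed

text \<open>All triples through one vertex inside a set of about \<open>\<surd>x N\<close> vertices have every pair of that
  set in their shadow, but there are only quadratically many of them.\<close>
lemma common_vertex_feasible:
  assumes x: "x \<in> {0..1}" and free: "\<And>H. triple_system H \<Longrightarrow> has_common_vertex H \<Longrightarrow> free_of \<F> H"
  shows "(x, 0) \<in> feasible_region 3 \<F>"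
proof -
  define m where "m k = nat \<lfloor>sqrt x * real k\<rfloor> + 3" for k
  define H where "H k = star (k + 3) (m k)" for k
  have sx: "0 \<le> sqrt x" "sqrt x \<le> 1" "sqrt x * sqrt x = x" using x by auto
  have mk: "real (m k) \<le> sqrt x * k + 3" "sqrt x * k + 2 \<le> real (m k)" for k
  proof -
    have "0 \<le> sqrt x * real k" using sx by simp
    then have "real (nat \<lfloor>sqrt x * real k\<rfloor>) = of_int \<lfloor>sqrt x * real k\<rfloor>" by simp
    then show "real (m k) \<le> sqrt x * k + 3" "sqrt x * k + 2 \<le> real (m k)" unfolding m_def by linarith+
  qed
  have m3: "3 \<le> m k" for k by (simp add: m_def)
  have mle: "m k \<le> k + 3" for k
    using mk(1)[of k] mult_right_mono[OF sx(2), of "real k"] by linarith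
  have H: "triple_system (H k)" "has_common_vertex (H k)" for k using star_basic[OF mle] by (auto simp: H_def)
  have N: "card (verts (H k)) = k + 3" for k by (simp add: H_def star_def)
  have lim: "filterlim (\<lambda>k. card (verts (H k))) at_top sequentially"
    "filterlim (\<lambda>k. card (verts (shadow 3 (H k)))) at_top sequentially"
    unfolding N shadow_def fst_conv by (rule filterlim_add_const_nat_at_top)+
  have "(\<lambda>k. 6 * (card (edges (H k)) / real (k + 3) ^ 3)) \<longlonglongrightarrow> 0"
  proof (rule tendsto_sandwich[OF _ _ tendsto_const])
    have "card (edges (H k)) \<le> (k + 3)^2" for k using common_vertex_card_le[OF H] N[of k] by metis
    then have "real (card (edges (H k))) \<le> real (k + 3)^2" for k by (metis of_nat_le_iff of_nat_power)
    then show "\<forall>\<^sub>F k in sequentially. 6 * (card (edges (H k)) / real (k + 3) ^ 3) \<le> 6 * (real (k + 3) ^ 2 / real (k + 3) ^ 3)"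
      by (intro always_eventually allI mult_left_mono divide_right_mono) auto
    show "(\<lambda>k. 6 * (real (k + 3) ^ 2 / real (k + 3) ^ 3)) \<longlonglongrightarrow> 0" by real_asymp
  qed simp
  then have "(\<lambda>k. density 3 (H k)) \<longlonglongrightarrow> 0"
    using density_tendsto_iff[OF lim(1), of 3 0] by (simp add: fact_numeral N)
  moreover have "(\<lambda>k. density (3 - 1) (shadow 3 (H k))) \<longlonglongrightarrow> x"
  proof -
    have m1: "(\<lambda>k. real (m k) / real (k + 3)) \<longlonglongrightarrow> sqrt x"
    proof (rule tendsto_sandwich)
      have q: "3 / real (k + 3) * real (k + 3) = 3" for k by (simp del: of_nat_add)
      have lower: "(sqrt x - 3 / real (k + 3)) * real (k + 3) = sqrt x * k + 3 * sqrt x - 3" for k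
        unfolding left_diff_distrib q by (simp add: algebra_simps)
      have upper: "(sqrt x + 3 / real (k + 3)) * real (k + 3) = sqrt x * k + 3 * sqrt x + 3" for k
        unfolding distrib_right q by (simp add: algebra_simps)
      have "(sqrt x - 3 / real (k + 3)) * real (k + 3) \<le> real (m k)" for k
        unfolding lower using mk[of k] sx by linarith
      then show "\<forall>\<^sub>F k in sequentially. sqrt x - 3 / real (k + 3) \<le> real (m k) / real (k + 3)"
        by (intro always_eventually allI) (subst pos_le_divide_eq, auto)
      have "real (m k) \<le> (sqrt x + 3 / real (k + 3)) * real (k + 3)" for k
        unfolding upper using mk[of k] sx by linarith
      then show "\<forall>\<^sub>F k in sequentially. real (m k) / real (k + 3) \<le> sqrt x + 3 / real (k + 3)"
        by (intro always_eventually allI) (subst pos_divide_le_eq, auto)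
      have "(\<lambda>k. 3 / real (k + 3)) \<longlonglongrightarrow> 0" by real_asymp
      from tendsto_diff[OF tendsto_const this] tendsto_add[OF tendsto_const this]
      show "(\<lambda>k. sqrt x - 3 / real (k + 3)) \<longlonglongrightarrow> sqrt x" "(\<lambda>k. sqrt x + 3 / real (k + 3)) \<longlonglongrightarrow> sqrt x"
        by (metis diff_zero, metis add_0_right)
    qed
    have "(\<lambda>k. 1 / real (k + 3)) \<longlonglongrightarrow> 0" by real_asymp
    from tendsto_mult[OF m1 tendsto_diff[OF m1 this]]
    have "(\<lambda>k. real (m k) / real (k + 3) * (real (m k) / real (k + 3) - 1 / real (k + 3))) \<longlonglongrightarrow> x"
      using sx(3) by simp
    moreover have "2 * (card (edges (shadow 3 (H k))) / real (k + 3) ^ 2)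
        = real (m k) / real (k + 3) * (real (m k) / real (k + 3) - 1 / real (k + 3))" for k
      using edges_shadow_star[OF m3 mle]
      by (simp add: H_def card_nsets real_choose_2 power2_eq_square diff_divide_distrib[symmetric] del: of_nat_add)
    ultimately have "(\<lambda>k. 2 * (card (edges (shadow 3 (H k))) / real (k + 3) ^ 2)) \<longlonglongrightarrow> x" by simp
    moreover have "card (verts (shadow 3 (H k))) = k + 3" for k using N[of k] by (simp add: shadow_def)
    ultimately show ?thesis
      using density_tendsto_iff[OF lim(2), of 2 x] by (simp add: fact_numeral)
  qed
  ultimately show ?thesis using x lim(1) H free by (intro feasible_regionI[where H = H]) auto
qed

section \<open>Patterns with equal Lagrangians\<close>

text \<open>The vertex set is split into three classes of size \<open>m\<close>. For each shift \<open>k < r\<close>, the triples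
  \<open>{x, m + x, 2m + (x + k) mod m}\<close> form a perfect matching, and the matchings for different shifts are
  disjoint.\<close>
lemma exists_regular:
  assumes "r \<le> m"
  obtains D where "D \<subseteq> nsets {..<3 * m} 3" "\<And>v. v < 3 * m \<Longrightarrow> card {e\<in>D. v \<in> e} = r"
proof
  define T where "T = (\<lambda>(x, k). {x, m + x, 2 * m + (x + k) mod m})"
  define P where "P = {..<m} \<times> {..<r}"
  have T_inj: "inj_on T P"
  proof (rule inj_onI, clarify)
    fix x k x' k' assume *: "(x, k) \<in> P" "(x', k') \<in> P" "T (x, k) = T (x', k')"
    then have lt: "x < m" "x' < m" "k < m" "k' < m" using assms by (auto simp: P_def)
    have res: "(x + k) mod m < m" "(x' + k') mod m < m" using lt by auto
    have "x \<in> T (x', k')" "2 * m + (x + k) mod m \<in> T (x', k')"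
      unfolding *(3)[symmetric] by (simp_all add: T_def)
    then have mem: "x = x' \<or> x = m + x' \<or> x = 2 * m + (x' + k') mod m"
      "2 * m + (x + k) mod m = x' \<or> 2 * m + (x + k) mod m = m + x' \<or> (x + k) mod m = (x' + k') mod m"
      by (simp_all add: T_def)
    have "x = x'" using mem(1) lt by linarith
    have "(x + k) mod m = (x' + k') mod m" using mem(2) lt by linarith
    moreover have "(x + l) mod m = (if x + l < m then x + l else x + l - m)" if "l < m" for l
      using lt(1) that by (simp add: mod_if)
    ultimately have "k = k'"
      using lt \<open>x = x'\<close> by (simp split: if_splits)
    then show "x = x' \<and> k = k'" using \<open>x = x'\<close> by simp
  qed
  have memT: "v \<in> T (x, k) \<longleftrightarrow> v = x \<or> v = m + x \<or> v = 2 * m + (x + k) mod m" for v x k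
    by (simp add: T_def)
  show "T ` P \<subseteq> nsets {..<3 * m} 3"
  proof clarify
    fix x k assume "(x, k) \<in> P"
    then have "x < m" "(x + k) mod m < m" by (auto simp: P_def)
    then show "T (x, k) \<in> nsets {..<3 * m} 3" by (auto simp: T_def nsets_def)
  qed
  fix v assume v: "v < 3 * m"
  have "{e\<in>T ` P. v \<in> e} = T ` {p\<in>P. v \<in> T p}" by auto
  then have "card {e\<in>T ` P. v \<in> e} = card {p\<in>P. v \<in> T p}"
    using T_inj by (simp add: card_image inj_on_subset)
  also have "\<dots> = r"
  proof -
    consider "v < m" | "m \<le> v" "v < 2 * m" | "2 * m \<le> v" "v < 3 * m" using v by linarith
    then show ?thesis
    proof cases
      case 1
      then have "{p\<in>P. v \<in> T p} = {v} \<times> {..<r}" by (auto simp: P_def memT)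
      then show ?thesis by simp
    next
      case 2
      then have "{p\<in>P. v \<in> T p} = {v - m} \<times> {..<r}" by (auto simp: P_def memT)
      then show ?thesis by simp
    next
      case 3
      define w where "w = v - 2 * m"
      have w: "w < m" "v = 2 * m + w" using 3 by (auto simp: w_def)
      define f where "f k = ((w + (m - k)) mod m, k)" for k
      have "{p\<in>P. v \<in> T p} = f ` {..<r}"
      proof (intro equalityI subsetI)
        fix p assume "p \<in> {p\<in>P. v \<in> T p}"
        then obtain x k where p: "p = (x, k)" "x < m" "k < r" "w = (x + k) mod m"
          using w by (auto simp: P_def memT)
        have "(w + (m - k)) mod m = (x + k + (m - k)) mod m" by (simp add: p mod_add_left_eq)
        also have "\<dots> = x" using p assms by simp
        finally have "p = f k" using p(1) by (simp add: f_def)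
        then show "p \<in> f ` {..<r}" using p(3) by blast
      next
        fix p assume "p \<in> f ` {..<r}"
        then obtain k where k: "k < r" "p = f k" by auto
        have "((w + (m - k)) mod m + k) mod m = (w + (m - k) + k) mod m" by (simp add: mod_add_left_eq)
        also have "\<dots> = w" using k assms w by simp
        finally show "p \<in> {p\<in>P. v \<in> T p}" using k w by (auto simp: f_def P_def memT)
      qed
      moreover have "inj_on f {..<r}" by (auto simp: f_def intro: inj_onI)
      ultimately show ?thesis by (simp add: card_image)
    qed
  qed
  finally show "card {e\<in>T ` P. v \<in> e} = r" .
qed

lemma exists_uniform_pattern:
  fixes \<alpha> \<delta> :: real and n r :: nat
  assumes "3 dvd n" "0 < n" and \<alpha>: "\<alpha> * real n ^ 2 = (real n - 1) * (real n - 2) - 2 * r"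
    and \<delta>: "0 < \<delta>" "\<delta> \<le> 1/16" "16 * r^2 * \<delta> \<le> n" "2 * r \<le> \<delta> * n" "32 \<le> \<delta>^2 * n"
  obtains G where "uniform_pattern \<alpha> n G"
proof -
  obtain m where m: "n = 3 * m" using assms(1) by auto
  have "real r \<le> m" using \<delta>(4) mult_right_mono[OF \<delta>(2), of "real n"] m by simp
  then obtain D where D: "D \<subseteq> nsets {..<n} 3" "\<And>v. v < n \<Longrightarrow> card {e\<in>D. v \<in> e} = r"
    using exists_regular[of r m] m by auto
  define G :: hypergraph where "G = ({..<n}, nsets {..<n} 3 - D)"
  have fin: "finite (nsets {..<n} 3)" by (simp add: finite_imp_finite_nsets)
  then have finD: "finite D" using D(1) finite_subset by blast
  have DP: "D \<subseteq> Pow {..<n}" using D(1) by (auto simp: nsets_def)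
  have "(\<Sum>e\<in>D. \<Sum>v\<in>e. (1::real)) = (\<Sum>e\<in>D. 3)"
    using D(1) by (intro sum.cong refl) (auto simp: nsets_def)
  then have cD: "3 * real (card D) = r * n"
    using sum_regular[OF _ DP, of r "\<lambda>v. 1"] D(2) by simp
  have "card D \<le> n choose 3" using card_mono[OF fin D(1)] by (simp add: card_nsets)
  then have "real (card (edges G)) = real (n choose 3) - card D"
    using D(1) by (simp add: G_def card_Diff_subset finD card_nsets of_nat_diff)
  then have "6 * real (card (edges G)) = n * ((real n - 1) * (real n - 2) - 2 * r)"
    using cD by (simp add: real_choose_3 algebra_simps)
  also have "\<dots> = \<alpha> * n^3" unfolding \<alpha>[symmetric] by (simp add: power2_eq_square power3_eq_cube)
  finally have "6 * real (card (edges G)) = \<alpha> * n^3" .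
  moreover have "6 * wsum (edges G) y \<le> \<alpha> - ((\<Sum>i<n. (y i)^2) - 1 / n) / 2"
    if "\<forall>i. 0 \<le> y i" "sum y {..<n} = 1" for y
  proof -
    have "\<alpha> = ((real n - 1) * (real n - 2) - 2 * r) / n^2" using \<alpha> \<open>0 < n\<close> by (simp add: field_simps)
    also have "\<dots> = 1 - 3/n + 2/n^2 - 2*r/n^2" using \<open>0 < n\<close> by (simp add: field_simps power2_eq_square)
    finally show ?thesis
      using wsum_co_regular_le[of "{..<n}" n D r y \<delta>] D \<delta> that \<open>0 < n\<close> by (simp add: G_def)
  qed
  ultimately have "uniform_pattern \<alpha> n G"
    unfolding uniform_pattern_def using \<open>0 < n\<close> by (auto simp: G_def r_graph_def)
  then show ?thesis using that by blast
qed

text \<open>The requirement \<open>(n - 1)(n - 2) - 2r = \<alpha> n\<^sup>2\<close> with \<open>\<alpha> = 1 - 1/Q\<^sup>2\<close> and \<open>n = Q a\<close> reads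
  \<open>2r = a\<^sup>2 - 3Qa + 2\<close>, which makes \<open>a = 3Q\<close> the natural starting point. For \<open>a = 3Q + 2i\<close> it gives
  \<open>r = i a + 1\<close>, which is of order \<open>i \<surd>n\<close>.\<close>
lemma exists_equal_patterns:
  assumes "0 < t"
  obtains \<alpha> :: real and n :: "nat \<Rightarrow> nat" and G where "0 < \<alpha>" "\<alpha> < 1" "strict_mono n" "0 < n 1"
    "\<And>i. i \<in> {1..t} \<Longrightarrow> uniform_pattern \<alpha> (n i) (G i)"
proof -
  \<comment> \<open>The bound \<open>r \<le> 5tQ\<close> together with \<open>n \<ge> 3Q\<^sup>2\<close> dictates \<open>\<delta>\<close> of order \<open>1/t\<^sup>2\<close>, and \<open>2r \<le> \<delta> n\<close> then needs
    \<open>Q\<close> of order \<open>t\<^sup>3\<close>. The factor 3 makes \<open>n\<close> divisible by 3.\<close>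
  define Q where "Q = 3000 * t^3"
  define \<delta> where "\<delta> = 1 / (400 * real t^2)"
  define n where "n i = Q * (3 * Q + 2 * i)" for i
  define r where "r i = i * (3 * Q + 2 * i) + 1" for i
  define \<alpha> where "\<alpha> = 1 - 1 / real Q^2"
  have t1: "1 \<le> real t" using assms by simp
  have tpow: "1 \<le> real t^k" for k using t1 by simp
  have Qr: "real Q = 3000 * real t^3" by (simp add: Q_def)
  have Qpos: "0 < Q" using assms by (simp add: Q_def)
  have tQ: "3000 * real t \<le> Q"
  proof -
    have "real t * 1 \<le> real t * real t^2" using tpow[of 2] by (intro mult_left_mono) auto
    then show ?thesis unfolding Qr by (simp add: power3_eq_cube power2_eq_square)
  qed
  have \<delta>: "0 < \<delta>" "\<delta> \<le> 1/16"
  proof -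
    have "16 \<le> 400 * real t^2" using tpow[of 2] by linarith
    then show "\<delta> \<le> 1/16" unfolding \<delta>_def by (intro frac_le) auto
  qed (use assms in \<open>simp add: \<delta>_def\<close>)
  have \<delta>t: "\<delta> * real t^2 = 1/400" using assms by (simp add: \<delta>_def)
  have \<delta>Q: "\<delta> * real Q = 3000 / 400 * real t"
    using assms by (simp add: \<delta>_def Qr power2_eq_square power3_eq_cube)
  have "\<exists>G. uniform_pattern \<alpha> (n i) G" if i: "i \<in> {1..t}" for i
  proof -
    have n_ge: "3 * real Q^2 \<le> n i" by (simp add: n_def power2_eq_square algebra_simps)
    have r_le: "real (r i) \<le> 5 * t * Q"
    proof -
      have "real i * (3 * real Q + 2 * i) \<le> real t * (3 * real Q + 2 * t)"
        using i by (intro mult_mono) auto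
      also have "\<dots> \<le> real t * (4 * real Q)" using tQ by (intro mult_left_mono) auto
      also have "\<dots> + 1 \<le> 5 * t * Q"
      proof -
        have "1 * 1 \<le> real t * real Q" using t1 Qpos by (intro mult_mono) auto
        then show ?thesis by (simp add: mult.commute)
      qed
      finally show ?thesis by (simp add: r_def)
    qed
    have "\<alpha> * real (n i)^2 = (real (n i) - 1) * (real (n i) - 2) - 2 * r i"
    proof -
      have \<alpha>Q: "\<alpha> * real Q^2 = real Q^2 - 1" using Qpos by (simp add: \<alpha>_def field_simps)
      have "\<alpha> * real (n i)^2 = (\<alpha> * real Q^2) * (3 * real Q + 2 * i)^2"
        by (simp add: n_def power_mult_distrib)
      then show ?thesis unfolding \<alpha>Q by (simp add: n_def r_def power2_eq_square algebra_simps)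
    qed
    moreover have "16 * (r i)^2 * \<delta> \<le> n i"
    proof -
      have "16 * real (r i)^2 * \<delta> \<le> 16 * (5 * t * real Q)^2 * \<delta>"
        using r_le \<delta> by (intro mult_right_mono mult_left_mono power_mono) auto
      also have "\<dots> = 400 * (\<delta> * real t^2) * real Q^2" by (simp add: power_mult_distrib)
      also have "\<dots> \<le> 3 * real Q^2" unfolding \<delta>t by simp
      finally show ?thesis using n_ge by simp
    qed
    moreover have "2 * r i \<le> \<delta> * n i"
    proof -
      have "10 * t * real Q \<le> 3 * (3000 / 400 * real t) * real Q" by (simp add: mult_right_mono)
      also have "\<dots> = \<delta> * (3 * real Q^2)" unfolding \<delta>Q[symmetric] by (simp add: power2_eq_square)
      also have "\<dots> \<le> \<delta> * n i" using n_ge \<delta> by (intro mult_left_mono) auto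
      finally show ?thesis using r_le by simp
    qed
    moreover have "32 \<le> \<delta>^2 * n i"
    proof -
      have "32 \<le> 3 * (3000 / 400 * real t)^2" using tpow[of 2] by (simp add: power_mult_distrib power_divide)
      also have "\<dots> = \<delta>^2 * (3 * real Q^2)" unfolding \<delta>Q[symmetric] by (simp add: power_mult_distrib)
      also have "\<dots> \<le> \<delta>^2 * n i" using n_ge by (intro mult_left_mono) auto
      finally show ?thesis .
    qed
    moreover have "3 dvd n i" by (simp add: n_def Q_def)
    moreover have "0 < n i" using Qpos by (simp add: n_def)
    ultimately show ?thesis using \<delta> exists_uniform_pattern[of "n i" \<alpha> "r i" \<delta>] by metis
  qed
  then obtain G where "\<And>i. i \<in> {1..t} \<Longrightarrow> uniform_pattern \<alpha> (n i) (G i)" by metis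
  moreover have "0 < \<alpha>" "\<alpha> < 1"
  proof -
    have "1 < real Q" using tQ t1 by linarith
    then show "0 < \<alpha>" "\<alpha> < 1" by (simp_all add: \<alpha>_def field_simps)
  qed
  moreover have "strict_mono n" using Qpos by (intro strict_monoI) (simp add: n_def)
  moreover have "0 < n 1" using Qpos by (simp add: n_def)
  ultimately show ?thesis using that by blast
qed

section \<open>Attainment of the feasible region function\<close>

text \<open>A diagonal sequence: its \<open>k\<close>-th member comes from a sequence realising a point at height within
  \<open>1/(k + 1)\<close> of \<open>s\<close>.\<close>
lemma feasible_region_limit:
  assumes y: "\<And>\<epsilon>. 0 < \<epsilon> \<Longrightarrow> \<exists>y. (x, y) \<in> feasible_region r \<F> \<and> \<bar>y - s\<bar> < \<epsilon>"
  shows "(x, s) \<in> feasible_region r \<F>"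
proof -
  have x: "x \<in> {0..1}" using y[of 1] by (auto simp: feasible_region_def)
  have s: "s \<in> {0..1}"
  proof (rule ccontr)
    assume "s \<notin> {0..1}"
    then have "0 < max (-s) (s - 1)" by auto
    from y[OF this] obtain y where "(x, y) \<in> feasible_region r \<F>" "\<bar>y - s\<bar> < max (-s) (s - 1)" by blast
    then show False by (auto simp: feasible_region_def)
  qed
  have "\<exists>H. r_graph r H \<and> free_of \<F> H \<and> k \<le> card (verts H) \<and>
      \<bar>density (r - 1) (shadow r H) - x\<bar> < 1 / Suc k \<and> \<bar>density r H - s\<bar> < 2 / Suc k" for k :: nat
  proof -
    have pos: "0 < 1 / real (Suc k)" by simp
    from y[OF pos] obtain y where y': "(x, y) \<in> feasible_region r \<F>" "\<bar>y - s\<bar> < 1 / Suc k" by blast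
    then obtain H where H: "\<And>j. r_graph r (H j)" "\<And>j. free_of \<F> (H j)"
      "filterlim (\<lambda>j. card (verts (H j))) at_top sequentially"
      "(\<lambda>j. density (r - 1) (shadow r (H j))) \<longlonglongrightarrow> x" "(\<lambda>j. density r (H j)) \<longlonglongrightarrow> y"
      unfolding feasible_region_def by auto
    have "\<forall>\<^sub>F j in sequentially. k \<le> card (verts (H j))" using H(3) by (simp add: filterlim_at_top)
    moreover have "\<forall>\<^sub>F j in sequentially. dist (density (r - 1) (shadow r (H j))) x < 1 / Suc k"
      by (rule tendstoD[OF H(4) pos])
    moreover have "\<forall>\<^sub>F j in sequentially. dist (density r (H j)) y < 1 / Suc k"
      by (rule tendstoD[OF H(5) pos])
    ultimately have "\<forall>\<^sub>F j in sequentially. k \<le> card (verts (H j)) \<and>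
       dist (density (r - 1) (shadow r (H j))) x < 1 / Suc k \<and> dist (density r (H j)) y < 1 / Suc k"
      by eventually_elim blast
    then obtain j where j: "k \<le> card (verts (H j))" "dist (density (r - 1) (shadow r (H j))) x < 1 / Suc k"
      "dist (density r (H j)) y < 1 / Suc k" using eventually_happens'[OF sequentially_bot] by blast
    have "\<bar>density r (H j) - s\<bar> < 1 / Suc k + 1 / Suc k" using j(3) y'(2) unfolding dist_real_def by linarith
    then show ?thesis using j H(1,2) by (intro exI[of _ "H j"]) (simp add: dist_real_def)
  qed
  then obtain H where H: "\<And>k. r_graph r (H k) \<and> free_of \<F> (H k) \<and> k \<le> card (verts (H k)) \<and>
      \<bar>density (r - 1) (shadow r (H k)) - x\<bar> < 1 / Suc k \<and> \<bar>density r (H k) - s\<bar> < 2 / Suc k"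
    by metis
  have conv: "f \<longlonglongrightarrow> l" if "\<And>k. \<bar>f k - l\<bar> < c / Suc k" for f l and c :: real
  proof -
    have "(\<lambda>k. c / Suc k) \<longlonglongrightarrow> 0" by real_asymp
    then have "(\<lambda>k. f k - l) \<longlonglongrightarrow> 0"
      by (rule Lim_null_comparison[rotated]) (use that in \<open>auto intro!: always_eventually less_imp_le simp: real_norm_def\<close>)
    then show ?thesis by (simp add: LIM_zero_iff)
  qed
  show ?thesis
  proof (rule feasible_regionI[OF x s])
    show "filterlim (\<lambda>k. card (verts (H k))) at_top sequentially"
      using H by (intro filterlim_at_top_mono[OF filterlim_ident] always_eventually) auto
    show "(\<lambda>k. density (r - 1) (shadow r (H k))) \<longlonglongrightarrow> x" by (rule conv[of _ _ 1]) (use H in auto)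
    show "(\<lambda>k. density r (H k)) \<longlonglongrightarrow> s" by (rule conv[of _ _ 2]) (use H in auto)
  qed (use H in auto)
qed

lemma feasible_fun_greatest:
  assumes "(x, y) \<in> feasible_region r \<F>"
  shows "(x, feasible_fun r \<F> x) \<in> feasible_region r \<F>" "y \<le> feasible_fun r \<F> x"
proof -
  define A where "A = {y. (x, y) \<in> feasible_region r \<F>}"
  have ne: "A \<noteq> {}" and bdd: "bdd_above A"
    using assms by (auto simp: A_def feasible_region_def intro!: bdd_aboveI[of _ 1])
  have up: "y \<le> Sup A" if "(x, y) \<in> feasible_region r \<F>" for y
    using that bdd by (intro cSup_upper) (auto simp: A_def)
  have in_A: "(x, Sup A) \<in> feasible_region r \<F>"
  proof (rule feasible_region_limit)
    fix \<epsilon> :: real assume "0 < \<epsilon>"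
    then obtain y where y: "y \<in> A" "Sup A - \<epsilon> < y" using less_cSup_iff[OF ne bdd, of "Sup A - \<epsilon>"] by auto
    then have "(x, y) \<in> feasible_region r \<F>" by (simp add: A_def)
    then show "\<exists>y. (x, y) \<in> feasible_region r \<F> \<and> \<bar>y - Sup A\<bar> < \<epsilon>" using y(2) up[of y] \<open>0 < \<epsilon>\<close> by (intro exI[of _ y]) auto
  qed
  have "feasible_fun r \<F> x = Sup A"
    unfolding feasible_fun_def using in_A up by (rule Greatest_equality)
  then show "(x, feasible_fun r \<F> x) \<in> feasible_region r \<F>" "y \<le> feasible_fun r \<F> x"
    using in_A up[OF assms] by simp_all
qed

section \<open>The feasible region of the joint obstructions\<close>

text \<open>Along a sequence of triple systems without joint obstructions, one of the finitely many properties
  holds locally infinitely often. The limit point is thus realised by a subsequence to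
  which the bounds for that property apply.\<close>
lemma joint_region_bound:
  assumes G: "\<And>i. i \<in> I \<Longrightarrow> uniform_pattern \<alpha> (n i) (G i)" "finite I" "0 < \<alpha>"
    and m: "12 \<le> m" "\<And>i. i \<in> I \<Longrightarrow> (n i + 1) + 3 * (n i + 1)^2 \<le> m"
    and \<P>: "\<P> = insert has_common_vertex ((\<lambda>i. colourable (G i)) ` I)" "m * card \<P> \<le> K"
    and xy: "(x, y) \<in> feasible_region 3 (joint_obstructions K \<P>)"
  shows "y \<le> \<alpha>" "y = \<alpha> \<Longrightarrow> \<exists>i\<in>I. x = 1 - 1 / real (n i)"
proof -
  obtain H where H: "\<And>k. triple_system (H k)" "\<And>k. free_of (joint_obstructions K \<P>) (H k)"
    and lim: "filterlim (\<lambda>k. card (verts (H k))) at_top sequentially"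
    and dx: "(\<lambda>k. density (3 - 1) (shadow 3 (H k))) \<longlonglongrightarrow> x" and dy: "(\<lambda>k. density 3 (H k)) \<longlonglongrightarrow> y"
    using xy unfolding feasible_region_def by auto
  have fin\<P>: "finite \<P>" using G(2) \<P>(1) by simp
  have "\<forall>k\<in>UNIV. \<exists>P\<in>\<P>. locally_satisfies m P (H k)"
    using free_of_joint_obstructionsD[OF H(1) H(2) fin\<P> _ \<P>(2)] colourable_monotone common_vertex_monotone \<P>(1)
    by (metis (no_types, lifting) imageE insertE)
  from pigeonhole_infinite_rel[OF infinite_UNIV_nat fin\<P> this]
  obtain P where P: "P \<in> \<P>" "infinite {k. locally_satisfies m P (H k)}" by auto
  obtain \<rho> :: "nat \<Rightarrow> nat" where \<rho>: "strict_mono \<rho>" "\<And>k. locally_satisfies m P (H (\<rho> k))"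
    using infinite_enumerate[OF P(2)] by auto
  define J where "J k = H (\<rho> k)" for k
  let ?N = "\<lambda>k. card (verts (J k))"
  let ?e = "\<lambda>k. card (edges (J k)) / real (?N k) ^ 3" and ?s = "\<lambda>k. card (edges (shadow 3 (J k))) / real (?N k) ^ 2"
  have J: "triple_system (J k)" "locally_satisfies m P (J k)" for k using H \<rho> by (auto simp: J_def)
  have limJ: "filterlim ?N at_top sequentially" "filterlim (\<lambda>k. card (verts (shadow 3 (J k)))) at_top sequentially"
    using filterlim_compose[OF lim filterlim_subseq[OF \<rho>(1)]] by (simp_all add: J_def shadow_def)
  have ev: "\<forall>\<^sub>F k in sequentially. 0 < ?N k"
    using limJ(1) unfolding filterlim_at_top by (metis (no_types, lifting) eventually_mono less_eq_Suc_le)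
  have "(\<lambda>k. density 3 (J k)) \<longlonglongrightarrow> y" "(\<lambda>k. density 2 (shadow 3 (J k))) \<longlonglongrightarrow> x"
    using LIMSEQ_subseq_LIMSEQ[OF dy \<rho>(1)] LIMSEQ_subseq_LIMSEQ[OF dx \<rho>(1)] by (simp_all add: J_def o_def)
  then have ey: "(\<lambda>k. 6 * ?e k) \<longlonglongrightarrow> y" and sx: "(\<lambda>k. 2 * ?s k) \<longlonglongrightarrow> x"
    using density_tendsto_iff[OF limJ(1), of 3 y] density_tendsto_iff[OF limJ(2), of 2 x]
    by (simp_all add: fact_numeral shadow_def)
  consider "P = has_common_vertex" | i where "i \<in> I" "P = colourable (G i)" using P(1) \<P>(1) by blast
  then have "y \<le> \<alpha> \<and> (y = \<alpha> \<longrightarrow> (\<exists>i\<in>I. x = 1 - 1 / real (n i)))"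
  proof cases
    case 1
    have "y \<le> 0"
    proof (rule tendsto_le[OF sequentially_bot _ ey])
      have "(\<lambda>N. 6 / real N) \<longlonglongrightarrow> 0" by real_asymp
      then show "(\<lambda>k. 6 / real (?N k)) \<longlonglongrightarrow> 0" by (rule filterlim_compose[OF _ limJ(1)])
      show "\<forall>\<^sub>F k in sequentially. 6 * ?e k \<le> 6 / real (?N k)"
        using ev
      proof eventually_elim
        case (elim k)
        have "has_common_vertex (J k)" using locally_has_common_vertex[OF J(1) _ m(1)] J(2) 1 by simp
        then have "card (edges (J k)) \<le> (?N k)^2" by (rule common_vertex_card_le[OF J(1)])
        then have "real (card (edges (J k))) \<le> real (?N k)^2" by (metis of_nat_le_iff of_nat_power)
        then show ?case using elim by (simp add: field_simps power2_eq_square power3_eq_cube)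
      qed
    qed
    then show ?thesis using G(3) by simp
  next
    case (2 i)
    note bounds = uniform_pattern_bounds[OF G(1)[OF 2(1)] J(1) J(2)[unfolded 2(2)] m(2)[OF 2(1)] refl]
    have "\<forall>\<^sub>F k in sequentially. 6 * ?e k \<le> \<alpha>" using ev by eventually_elim (rule bounds(1))
    then have 3: "y \<le> \<alpha>" by (rule tendsto_upperbound[OF ey]) simp
    have "\<forall>\<^sub>F k in sequentially. 2 * ?s k \<le> 1 - 1 / n i" using ev by eventually_elim (rule bounds(2))
    then have 4: "x \<le> 1 - 1 / n i" by (rule tendsto_upperbound[OF sx]) simp
    have "y - x / 2 \<le> \<alpha> - (1 - 1 / n i) / 2"
    proof (rule tendsto_upperbound)
      show "(\<lambda>k. 6 * ?e k - 2 * ?s k / 2) \<longlonglongrightarrow> y - x / 2" by (intro tendsto_intros ey sx) simp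
      show "\<forall>\<^sub>F k in sequentially. 6 * ?e k - 2 * ?s k / 2 \<le> \<alpha> - (1 - 1 / n i) / 2"
        using ev by eventually_elim (use bounds(3) in simp)
    qed simp
    with 3 4 have "y \<le> \<alpha>" "y = \<alpha> \<longrightarrow> x = 1 - 1 / n i" by argo+
    then show ?thesis using 2(1) by blast
  qed
  then show "y \<le> \<alpha>" "y = \<alpha> \<Longrightarrow> \<exists>i\<in>I. x = 1 - 1 / real (n i)" by blast+
qed

theorem theorem1p2:
  fixes t :: nat
  assumes "0 < t"
  shows "\<exists>(n :: nat \<Rightarrow> nat) (lam :: real) (\<M> :: hypergraph set).
    0 < n 1 \<and> strict_mono_on {1..t} n \<and>
    0 < lam \<and> lam < 1 / 6 \<and>
    finite \<M> \<and> (\<forall>F\<in>\<M>. triple_system F) \<and>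
    proj_feasible 3 \<M> = {0..1} \<and>
    (\<forall>x\<in>{0..1}. feasible_fun 3 \<M> x \<le> 6 * lam) \<and>
    (\<forall>x\<in>{0..1}. feasible_fun 3 \<M> x = 6 * lam \<longleftrightarrow> (\<exists>i\<in>{1..t}. x = 1 - 1 / real (n i)))"
proof -
  obtain \<alpha> n G where \<alpha>: "0 < \<alpha>" "\<alpha> < 1" and n: "strict_mono n" "0 < n 1"
    and G: "\<And>i. i \<in> {1..t} \<Longrightarrow> uniform_pattern \<alpha> (n i) (G i)"
    using exists_equal_patterns[OF assms] by metis
  define \<P> where "\<P> = insert has_common_vertex ((\<lambda>i. colourable (G i)) ` {1..t})"
  define m where "m = 12 + (\<Sum>i\<in>{1..t}. (n i + 1) + 3 * (n i + 1)^2)"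
  have m: "12 \<le> m" "\<And>i. i \<in> {1..t} \<Longrightarrow> (n i + 1) + 3 * (n i + 1)^2 \<le> m"
  proof -
    fix i assume "i \<in> {1..t}"
    then have "(n i + 1) + 3 * (n i + 1)^2 \<le> (\<Sum>i\<in>{1..t}. (n i + 1) + 3 * (n i + 1)^2)"
      by (intro member_le_sum) auto
    then show "(n i + 1) + 3 * (n i + 1)^2 \<le> m" by (simp add: m_def)
  qed (simp add: m_def)
  define \<M> where "\<M> = joint_obstructions (m * card \<P>) \<P>"
  note bound = joint_region_bound[OF G finite_atLeastAtMost \<alpha>(1) m \<P>_def order_refl, folded \<M>_def]
  have base: "(x, 0) \<in> feasible_region 3 \<M>" if "x \<in> {0..1}" for x
    unfolding \<M>_def using that common_vertex_monotone
    by (intro common_vertex_feasible free_of_joint_obstructions[of _ has_common_vertex]) (simp_all add: \<P>_def)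
  have top: "(1 - 1 / real (n i), \<alpha>) \<in> feasible_region 3 \<M>" if "i \<in> {1..t}" for i
    unfolding \<M>_def using that \<alpha> colourable_monotone
    by (intro uniform_pattern_attained[OF G[OF that]] free_of_joint_obstructions[of _ "colourable (G i)"]) (auto simp: \<P>_def)
  have "proj_feasible 3 \<M> = {0..1}"
  proof (intro equalityI subsetI)
    show "x \<in> {0..1}" if "x \<in> proj_feasible 3 \<M>" for x
      using that by (auto simp: proj_feasible_def feasible_region_def)
    show "x \<in> proj_feasible 3 \<M>" if "x \<in> {0..1}" for x
      unfolding proj_feasible_def using base[OF that] by (auto intro!: bexI[of _ 0])
  qed
  moreover have "feasible_fun 3 \<M> x \<le> \<alpha>" if "x \<in> {0..1}" for x
    using bound(1) feasible_fun_greatest(1)[OF base[OF that]] by blast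
  moreover have "feasible_fun 3 \<M> x = \<alpha> \<longleftrightarrow> (\<exists>i\<in>{1..t}. x = 1 - 1 / real (n i))" if "x \<in> {0..1}" for x
  proof
    show "\<exists>i\<in>{1..t}. x = 1 - 1 / real (n i)" if "feasible_fun 3 \<M> x = \<alpha>"
      using bound(2) feasible_fun_greatest(1)[OF base[OF \<open>x \<in> {0..1}\<close>]] that by blast
  next
    assume "\<exists>i\<in>{1..t}. x = 1 - 1 / real (n i)"
    then have "(x, \<alpha>) \<in> feasible_region 3 \<M>" using top by blast
    then show "feasible_fun 3 \<M> x = \<alpha>"
      using bound(1) feasible_fun_greatest by (meson antisym)
  qed
  moreover have "finite \<M>" "\<forall>F\<in>\<M>. triple_system F"
    by (auto simp: \<M>_def finite_joint_obstructions) (simp add: joint_obstructions_def)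
  moreover have "strict_mono_on {1..t} n" using n(1) by (auto simp: strict_mono_def intro: strict_mono_onI)
  ultimately show ?thesis
    using \<alpha> n(2) by (intro exI[of _ n] exI[of _ "\<alpha> / 6"] exI[of _ \<M>]) auto
qed

end
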